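(* Let $N\geq 2$, $n\ge1$, $r\ge 1$, let $p_1,\dots,p_r$ be pairwise distinct points of $\mathbb{R}^N$, let $C$ be a set of $2$-element subsets of $\{1,\dots,n\}$ and $O\subseteq\{1,\dots,n\}\times\{1,\dots,r\}$. Then $\mathrm{Conf}_{C,O}(\mathbb{R}^N)$ has torsion free integral homology and $$P_t(\mathrm{Conf}_{C,O}(\mathbb{R}^N))= \frac{P_t(\mathrm{Conf}_{\Gamma(n,r)}(\mathbb{R}^N))}{P_t(\mathrm{Conf}_{K_r}(\mathbb{R}^N))}.$$
   Context: $\mathrm{Conf}_{C,O}(\mathbb{R}^N)=\{(x_1,\dots,x_n)\in(\mathbb{R}^N)^n: x_i\neq x_j \text{ for } \{i,j\}\in C,\ x_k\neq p_s\text{ for }(k,s)\in O\}$ (configurations of $n$ moving objects avoiding prescribed obstacles). $\Gamma(n,r)$ is the graph with vertex set $\{1,\dots,n+r\}$ and edges $\{i,j\}$ for $\{i,j\}\in C$, $\{k,n+s\}$ for $(k,s)\in O$, and $\{n+a,n+b\}$ for all $a\neq b$ in $\{1,\dots,r\}$ (so the vertices $n+1,\dots,n+r$ span a complete graph $K_r$). For a graph $\Gamma$ on $\{1,\dots,M\}$, $\mathrm{Conf}_{\Gamma}(X)=\{(x_1,\dots,x_M)\in X^M: x_i\neq x_j\text{ whenever }\{i,j\}\text{ is an edge}\}$, and $\mathrm{Conf}_{K_r}$ is the ordinary configuration space of $r$ distinct points. $P_t(Y)=\sum_i\mathrm{rank}\,H_i(Y;\mathbb{Z})\,t^i$. *)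

theory Defs
  imports "HOL-Analysis.Analysis" "HOL-Homology.Homology"
    "HOL-Computational_Algebra.Formal_Power_Series"
begin

definition torsion_free :: "('a, 'b) monoid_scheme \<Rightarrow> bool" where
  "torsion_free G \<longleftrightarrow>
     (\<forall>x\<in>carrier G. \<forall>k::nat. k > 0 \<longrightarrow> x [^]\<^bsub>G\<^esub> k = \<one>\<^bsub>G\<^esub> \<longrightarrow> x = \<one>\<^bsub>G\<^esub>)"

definition zindep :: "('a, 'b) monoid_scheme \<Rightarrow> 'a set \<Rightarrow> bool" where
  "zindep G S \<longleftrightarrow> finite S \<and> S \<subseteq> carrier G \<and>
     (\<forall>c::'a \<Rightarrow> int. finprod G (\<lambda>x. x [^]\<^bsub>G\<^esub> c x) S = \<one>\<^bsub>G\<^esub> \<longrightarrow> (\<forall>x\<in>S. c x = 0))"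

definition finite_rank :: "('a, 'b) monoid_scheme \<Rightarrow> bool" where
  "finite_rank G \<longleftrightarrow> bdd_above {card S | S. zindep G S}"

text \<open>rank = maximal size of an independent set (meaningful when finite_rank holds).\<close>
definition grank :: "('a, 'b) monoid_scheme \<Rightarrow> nat" where
  "grank G = Max {card S | S. zindep G S}"

definition poincare :: "'a topology \<Rightarrow> real fps" where
  "poincare X = Abs_fps (\<lambda>i. of_nat (grank (homology_group (int i) X)))"

text \<open>Conf_Gamma(R^N) for a graph Gamma on {1..M} given by its set E of 2-element edges.
  Points of (R^N)^M are functions on {1..M} (extensional), with the product topology.\<close>
definition conf_graph :: "nat \<Rightarrow> nat set set \<Rightarrow> (nat \<Rightarrow> 'a::euclidean_space) topology" where
  "conf_graph M E = subtopology (product_topology (\<lambda>_. euclidean) {1..M})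
     {x. \<forall>i j. {i, j} \<in> E \<longrightarrow> x i \<noteq> x j}"

definition conf_CO :: "nat \<Rightarrow> nat set set \<Rightarrow> (nat \<times> nat) set \<Rightarrow> (nat \<Rightarrow> 'a::euclidean_space)
    \<Rightarrow> (nat \<Rightarrow> 'a) topology" where
  "conf_CO n C Ob p = subtopology (product_topology (\<lambda>_. euclidean) {1..n})
     {x. (\<forall>i j. {i, j} \<in> C \<longrightarrow> x i \<noteq> x j) \<and> (\<forall>(k, s)\<in>Ob. x k \<noteq> p s)}"

definition complete_edges :: "nat \<Rightarrow> nat set set" where
  "complete_edges r = {{a, b} | a b. a \<in> {1..r} \<and> b \<in> {1..r} \<and> a \<noteq> b}"

definition gamma_edges :: "nat \<Rightarrow> nat \<Rightarrow> nat set set \<Rightarrow> (nat \<times> nat) set \<Rightarrow> nat set set" where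
  "gamma_edges n r C Ob = C \<union> {{k, n + s} | k s. (k, s) \<in> Ob}
     \<union> {{n + a, n + b} | a b. a \<in> {1..r} \<and> b \<in> {1..r} \<and> a \<noteq> b}"

end

(* A configuration space with some vertices free and the others pinned at given points satisfies
   deletion-contraction. Let e = {k, j} be an edge with k free. Near the locus x_k = x_j, the space of
   the graph E - e is a product of the space of the contracted graph E/e with R^N, so excision and the
   suspension (Thom) isomorphism identify the homology of the pair (X(E - e), X(E)) with that of X(E/e),
   shifted by N. By induction on the number of edges, with the four lemma, X(E') -> X(E) is surjective
   on homology whenever E is contained in E'. Hence the exact sequences of the pairs split into short ones,
   homology is free, and P(E) = P(E - e) + t^(N-1) P(E/e). For the edges e that meet the moving objects,
   the graph Gamma(n,r), in which the obstacles are free, obeys the same recursion; without such edges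
   it has Poincare polynomial P(K_r) while the space of objects is contractible. *)

theory Submission
  imports Defs
begin

section \<open>Rank and exact sequences\<close>

text \<open>Pinning treats obstacles and objects alike: contracting an edge from a free vertex to a
  pinned one pins the free vertex as well, so the class of spaces is closed under the recursion. The
  price is edges between two pinned vertices; these hold automatically because the pinned points are
  distinct.

  The locus \<open>x_k = x_j\<close> has no tube of uniform radius. Used instead is the open set of
  all displacements that the other edges allow. It sits in X(E - e) and in the product of X(E/e)
  with R^N, and excision is applied on both sides.

  Surjectivity is proved for arbitrary E inside E', since the induction step uses X(E') -> X(E - e),
  which replaces the injectivity on a relative group that the usual four lemma demands. Surjectivity
  on the relative groups has to be transported too, and so the Thom isomorphism comes with a
  statement about maps.

  Rank is the maximum of a set of cardinalities, so finiteness accompanies every rank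
  formula.\<close>

definition zind :: "('b, 'c) monoid_scheme \<Rightarrow> ('i \<Rightarrow> 'b) \<Rightarrow> 'i set \<Rightarrow> bool" where
  "zind G h S \<longleftrightarrow> finite S \<and> h \<in> S \<rightarrow> carrier G \<and>
     (\<forall>c::'i \<Rightarrow> int. finprod G (\<lambda>x. h x [^]\<^bsub>G\<^esub> c x) S = \<one>\<^bsub>G\<^esub> \<longrightarrow> (\<forall>x\<in>S. c x = 0))"

lemma hom_finprod:
  assumes "comm_group G" "comm_group H" "f \<in> hom G H" "h \<in> S \<rightarrow> carrier G"
  shows "f (finprod G h S) = finprod H (\<lambda>x. f (h x)) S"
proof -
  interpret G: comm_group G by fact
  interpret H: comm_group H by fact
  interpret group_hom G H f
    by (simp add: assms group_hom.intro group_hom_axioms.intro G.is_group H.is_group)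
  show ?thesis
    using assms(4)
  proof (induction S rule: infinite_finite_induct)
    case (insert x F)
    then have "(\<lambda>x. f (h x)) \<in> F \<rightarrow> carrier H" "f (h x) \<in> carrier H"
      by (auto simp: Pi_iff)
    with insert show ?case by (simp add: Pi_iff)
  qed auto
qed

lemma (in comm_group) finprod_int_pow_add:
  assumes "h \<in> S \<rightarrow> carrier G"
  shows "finprod G (\<lambda>x. h x [^] (c x + d x :: int)) S
       = finprod G (\<lambda>x. h x [^] c x) S \<otimes> finprod G (\<lambda>x. h x [^] d x) S"
proof -
  have "finprod G (\<lambda>x. h x [^] (c x + d x)) S = finprod G (\<lambda>x. h x [^] c x \<otimes> h x [^] d x) S"
    using assms by (intro finprod_cong') (auto simp: int_pow_mult Pi_iff)
  then show ?thesis
    using assms by (simp add: finprod_multf Pi_iff)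
qed

lemma (in comm_group) finprod_int_pow_mult:
  assumes "h \<in> S \<rightarrow> carrier G"
  shows "finprod G (\<lambda>x. h x [^] (c x * d :: int)) S = finprod G (\<lambda>x. h x [^] c x) S [^] d"
  using assms
proof (induction S rule: infinite_finite_induct)
  case (insert x F)
  then show ?case
    by (simp add: Pi_iff int_pow_pow int_pow_distrib)
qed auto

text \<open>Families are used because the image of a set under a homomorphism may have repetitions,
  which a set would hide. A repeated value gives the relation with coefficients 1 and -1, so an
  independent family has none and can be turned back into a set of the same size.\<close>

lemma (in comm_group) zind_imp_inj_on:
  assumes "zind G h S"
  shows "inj_on h S"
proof (rule inj_onI, rule ccontr)
  fix x y assume xy: "x \<in> S" "y \<in> S" "h x = h y" "x \<noteq> y"
  have fin: "finite S" and h: "h \<in> S \<rightarrow> carrier G" using assms by (auto simp: zind_def)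
  define c :: "'c \<Rightarrow> int" where "c = (\<lambda>z. if z = x then 1 else if z = y then -1 else 0)"
  have "finprod G (\<lambda>z. h z [^] c z) S = finprod G (\<lambda>z. h z [^] c z) {x,y}"
    using h xy fin by (intro finprod_mono_neutral_cong_right) (auto simp: c_def Pi_iff)
  also have "\<dots> = h x \<otimes> inv (h y)"
    using xy h by (simp add: c_def Pi_iff int_pow_neg)
  also have "\<dots> = \<one>"
    using xy h by (auto simp: Pi_iff)
  finally have "c x = 0"
    using assms xy by (auto simp: zind_def)
  then show False by (simp add: c_def)
qed

lemma (in comm_group) zind_imp_zindep:
  assumes "zind G h S"
  shows "zindep G (h ` S)" "card (h ` S) = card S"
proof -
  have inj: "inj_on h S" using assms by (rule zind_imp_inj_on)
  have h: "h \<in> S \<rightarrow> carrier G" using assms by (auto simp: zind_def)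
  show "card (h ` S) = card S" using inj by (rule card_image)
  have "finprod G (\<lambda>x. x [^] c x) (h ` S) = finprod G (\<lambda>x. h x [^] c (h x)) S" for c :: "'a \<Rightarrow> int"
    using h inj by (intro finprod_reindex) (auto simp: Pi_iff)
  then show "zindep G (h ` S)"
    using assms by (force simp: zindep_def zind_def)
qed

lemma zindep_empty: "zindep G {}"
  by (simp add: zindep_def)

text \<open>Finite rank makes the set of sizes finite, and the empty set makes it nonempty; together
  they give \<open>Max\<close> its meaning.\<close>

lemma grank_attained:
  assumes "comm_group G" "finite_rank G"
  obtains S where "zindep G S" "card S = grank G"
proof -
  let ?A = "{card S | S. zindep G S}"
  have "finite ?A" using assms(2) by (simp add: finite_rank_def bdd_above_nat)
  moreover have "?A \<noteq> {}" using zindep_empty[of G] by auto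
  ultimately have "Max ?A \<in> ?A" by (rule Max_in)
  then show ?thesis using that by (auto simp: grank_def)
qed

lemma card_le_grank:
  assumes "comm_group G" "finite_rank G" "zind G h S"
  shows "card S \<le> grank G"
proof -
  let ?A = "{card S | S. zindep G S}"
  have "finite ?A" using assms(2) by (simp add: finite_rank_def bdd_above_nat)
  moreover have "card S \<in> ?A" using comm_group.zind_imp_zindep[OF assms(1,3)] by force
  ultimately show ?thesis unfolding grank_def by (rule Max_ge)
qed

lemma grank_eqI:
  assumes "\<And>S. zindep G S \<Longrightarrow> card S \<le> n" "zindep G S0" "card S0 = n"
  shows "finite_rank G" "grank G = n"
proof -
  let ?A = "{card S | S. zindep G S}"
  show fr: "finite_rank G" unfolding finite_rank_def bdd_above_def using assms by auto
  then have "finite ?A" by (simp add: finite_rank_def bdd_above_nat)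
  then show "grank G = n" unfolding grank_def by (intro Max_eqI) (use assms in auto)
qed

text \<open>Independent families in the two outer groups glue to one in the middle group; conversely, an
  independent set of the middle group splits into a maximal part that stays independent in the
  quotient and a part for which suitable multiples can be moved into the subgroup.\<close>

context
  fixes A :: "('x, 'x2) monoid_scheme" and B :: "('y, 'y2) monoid_scheme" and C :: "('z, 'z2) monoid_scheme"
    and f g
  assumes A: "comm_group A" and B: "comm_group B" and C: "comm_group C"
    and f: "f \<in> hom A B" and g: "g \<in> hom B C"
    and injf: "inj_on f (carrier A)" and surjg: "g ` carrier B = carrier C"
    and ex: "f ` carrier A = kernel B C g"
begin

interpretation A: comm_group A by (rule A)
interpretation B: comm_group B by (rule B)
interpretation C: comm_group C by (rule C)
interpretation f: group_hom A B f
  by (simp add: f group_hom.intro group_hom_axioms.intro)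
interpretation g: group_hom B C g
  by (simp add: g group_hom.intro group_hom_axioms.intro)

lemma g_f_one: "a \<in> carrier A \<Longrightarrow> g (f a) = \<one>\<^bsub>C\<^esub>"
  using ex by (auto simp: kernel_def)

text \<open>A torsion element dies in \<open>C\<close>, hence comes from \<open>A\<close>; since
  \<open>f\<close> is injective, its preimage is torsion too, hence trivial.\<close>

lemma torsion_free_extension:
  assumes "torsion_free A" "torsion_free C"
  shows "torsion_free B"
  unfolding torsion_free_def
proof (intro ballI allI impI)
  fix x and k :: nat
  assume x: "x \<in> carrier B" and k: "k > 0" and xk: "x [^]\<^bsub>B\<^esub> k = \<one>\<^bsub>B\<^esub>"
  have "g x [^]\<^bsub>C\<^esub> k = \<one>\<^bsub>C\<^esub>"
    using x xk by (metis g.hom_nat_pow g.hom_one)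
  then have "g x = \<one>\<^bsub>C\<^esub>"
    using assms(2) x k by (auto simp: torsion_free_def)
  then obtain a where a: "a \<in> carrier A" "x = f a"
    using x ex by (auto simp: kernel_def)
  then have "f (a [^]\<^bsub>A\<^esub> k) = f \<one>\<^bsub>A\<^esub>"
    using xk by (simp add: f.hom_nat_pow)
  then have "a [^]\<^bsub>A\<^esub> k = \<one>\<^bsub>A\<^esub>"
    by (rule inj_onD[OF injf]) (use a in auto)
  then have "a = \<one>\<^bsub>A\<^esub>"
    using assms(1) a k by (auto simp: torsion_free_def)
  then show "x = \<one>\<^bsub>B\<^esub>" using a by simp
qed

lemma zindep_glue:
  assumes SA: "zindep A S" and SC: "zindep C T"
  shows "\<exists>U. zindep B U \<and> card U = card S + card T"
proof -
  have S: "finite S" "S \<subseteq> carrier A" and T: "finite T" "T \<subseteq> carrier C"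
    using SA SC by (auto simp: zindep_def)
  \<comment> \<open>Any lift of \<open>T\<close> along \<open>g\<close> will do, since its
    independence is tested only after applying \<open>g\<close>.\<close>
  define l where "l = inv_into (carrier B) g"
  have l: "l c \<in> carrier B \<and> g (l c) = c" if "c \<in> carrier C" for c
    using that surjg by (simp add: l_def f_inv_into_f inv_into_into)
  define h where "h = case_sum f l"
  have hS: "(\<lambda>x. h (Inl x)) \<in> S \<rightarrow> carrier B" using S by (auto simp: h_def)
  have hT: "(\<lambda>x. h (Inr x)) \<in> T \<rightarrow> carrier B" using T l by (auto simp: h_def)
  have "zind B h (S <+> T)"
    unfolding zind_def
  proof (intro conjI allI impI)
    show "finite (S <+> T)" using S T by simp
    show h: "h \<in> (S <+> T) \<rightarrow> carrier B" using hS hT by auto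
    fix c :: "'x + 'z \<Rightarrow> int"
    let ?h = "\<lambda>x. h x [^]\<^bsub>B\<^esub> c x"
    assume "finprod B ?h (S <+> T) = \<one>\<^bsub>B\<^esub>"
    moreover have "finprod B ?h (S <+> T) = finprod B ?h (Inl ` S) \<otimes>\<^bsub>B\<^esub> finprod B ?h (Inr ` T)"
      unfolding Plus_def using S T hS hT by (intro B.finprod_Un_disjoint) auto
    moreover have "finprod B ?h (Inl ` S) = finprod B (\<lambda>x. ?h (Inl x)) S"
      using hS by (intro B.finprod_reindex) auto
    moreover have "finprod B ?h (Inr ` T) = finprod B (\<lambda>x. ?h (Inr x)) T"
      using hT by (intro B.finprod_reindex) auto
    ultimately have eq: "finprod B (\<lambda>x. ?h (Inl x)) S \<otimes>\<^bsub>B\<^esub> finprod B (\<lambda>x. ?h (Inr x)) T = \<one>\<^bsub>B\<^esub>"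
      by simp
    have pS: "finprod B (\<lambda>x. ?h (Inl x)) S = f (finprod A (\<lambda>x. x [^]\<^bsub>A\<^esub> c (Inl x)) S)"
      using S by (subst hom_finprod[OF A B f]) (auto intro!: B.finprod_cong' simp: h_def f.hom_int_pow)
    have pT: "g (finprod B (\<lambda>x. ?h (Inr x)) T) = finprod C (\<lambda>x. x [^]\<^bsub>C\<^esub> c (Inr x)) T"
      using hT T l by (subst hom_finprod[OF B C g]) (auto intro!: C.finprod_cong' simp: h_def g.hom_int_pow subset_iff)
    have cA: "finprod A (\<lambda>x. x [^]\<^bsub>A\<^esub> c (Inl x)) S \<in> carrier A"
      using S by (intro A.finprod_closed) auto
    have cT: "finprod B (\<lambda>x. ?h (Inr x)) T \<in> carrier B"
      using hT by (intro B.finprod_closed) auto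
    \<comment> \<open>Applying \<open>g\<close> kills the part from \<open>A\<close>, so the
      coefficients on \<open>T\<close> vanish. What remains is a relation inside the image of
      \<open>f\<close>, which injectivity moves back to \<open>A\<close>.\<close>
    have "g (finprod B (\<lambda>x. ?h (Inl x)) S \<otimes>\<^bsub>B\<^esub> finprod B (\<lambda>x. ?h (Inr x)) T) = \<one>\<^bsub>C\<^esub>"
      using eq by simp
    then have "finprod C (\<lambda>x. x [^]\<^bsub>C\<^esub> c (Inr x)) T = \<one>\<^bsub>C\<^esub>"
      using cA cT T by (simp add: pS pT g_f_one subset_iff Pi_iff)
    then have T0: "\<forall>x\<in>T. c (Inr x) = 0" using SC by (auto simp: zindep_def)
    then have "finprod B (\<lambda>x. ?h (Inr x)) T = \<one>\<^bsub>B\<^esub>"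
      by (intro B.finprod_one_eqI) auto
    with eq pS cA have "f (finprod A (\<lambda>x. x [^]\<^bsub>A\<^esub> c (Inl x)) S) = f \<one>\<^bsub>A\<^esub>"
      by simp
    then have "finprod A (\<lambda>x. x [^]\<^bsub>A\<^esub> c (Inl x)) S = \<one>\<^bsub>A\<^esub>"
      by (rule inj_onD[OF injf]) (use cA in auto)
    then have "\<forall>x\<in>S. c (Inl x) = 0" using SA by (auto simp: zindep_def)
    with T0 show "\<forall>x\<in>S <+> T. c x = 0" by auto
  qed
  with S T show ?thesis
    using B.zind_imp_zindep[of h "S <+> T"] by (intro exI[of _ "h ` (S <+> T)"]) (simp add: card_Plus)
qed

lemma zindep_split:
  assumes S: "zindep B S"
  obtains T a where "T \<subseteq> S" "zind C g T" "zind A a (S - T)"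
proof -
  have fS: "finite S" and Sc: "S \<subseteq> carrier B" using S by (auto simp: zindep_def)
  \<comment> \<open>\<open>T\<close> is a maximal part of \<open>S\<close> whose image in
    \<open>C\<close> is still an independent family.\<close>
  have "\<exists>T \<in> {T. T \<subseteq> S \<and> zind C g T}. \<forall>U \<in> {T. T \<subseteq> S \<and> zind C g T}. T \<subseteq> U \<longrightarrow> T = U"
  proof (rule finite_has_maximal)
    show "finite {T. T \<subseteq> S \<and> zind C g T}"
      using fS by simp
    show "{T. T \<subseteq> S \<and> zind C g T} \<noteq> {}"
      by (auto simp: zind_def intro!: exI[of _ "{}"])
  qed
  then obtain T where T: "T \<subseteq> S" "zind C g T"
    and Tmax: "\<And>U. U \<subseteq> S \<Longrightarrow> zind C g U \<Longrightarrow> T \<subseteq> U \<Longrightarrow> T = U"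
    by auto
  have fT: "finite T" using T fS finite_subset by auto
  have gT: "g \<in> T \<rightarrow> carrier C" and Tc: "T \<subseteq> carrier B" using T Sc by auto
  \<comment> \<open>By maximality, adding \<open>s\<close> to \<open>T\<close> creates a relation in
    \<open>C\<close>. The same combination formed in \<open>B\<close> lies in the kernel of
    \<open>g\<close>, so it is \<open>f a\<close>. The coefficient of \<open>s\<close> is nonzero,
    as otherwise the relation would live on \<open>T\<close> alone.\<close>
  have "\<exists>c a. c s \<noteq> 0 \<and> a \<in> carrier A \<and>
      f a = s [^]\<^bsub>B\<^esub> (c s :: int) \<otimes>\<^bsub>B\<^esub> finprod B (\<lambda>t. t [^]\<^bsub>B\<^esub> c t) T" if s: "s \<in> S - T" for s
  proof -
    have sc: "s \<in> carrier B" using s Sc by auto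
    have "\<not> zind C g (insert s T)"
      using Tmax[of "insert s T"] s T(1) by auto
    then obtain c :: "'y \<Rightarrow> int" where c: "finprod C (\<lambda>x. g x [^]\<^bsub>C\<^esub> c x) (insert s T) = \<one>\<^bsub>C\<^esub>"
      and nz: "\<exists>x\<in>insert s T. c x \<noteq> 0"
      using fT gT sc by (auto simp: zind_def)
    have c': "g s [^]\<^bsub>C\<^esub> c s \<otimes>\<^bsub>C\<^esub> finprod C (\<lambda>x. g x [^]\<^bsub>C\<^esub> c x) T = \<one>\<^bsub>C\<^esub>"
      using c fT s sc gT by (subst (asm) C.finprod_insert) auto
    have "c s \<noteq> 0"
    proof
      assume "c s = 0"
      then have "finprod C (\<lambda>x. g x [^]\<^bsub>C\<^esub> c x) T = \<one>\<^bsub>C\<^esub>"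
        using c' gT by (simp add: Pi_iff)
      with T(2) have "\<forall>x\<in>T. c x = 0" by (auto simp: zind_def)
      with nz \<open>c s = 0\<close> show False by auto
    qed
    let ?y = "s [^]\<^bsub>B\<^esub> c s \<otimes>\<^bsub>B\<^esub> finprod B (\<lambda>t. t [^]\<^bsub>B\<^esub> c t) T"
    have pc: "finprod B (\<lambda>t. t [^]\<^bsub>B\<^esub> c t) T \<in> carrier B"
      using Tc by (intro B.finprod_closed) auto
    have "g (finprod B (\<lambda>t. t [^]\<^bsub>B\<^esub> c t) T) = finprod C (\<lambda>x. g x [^]\<^bsub>C\<^esub> c x) T"
      using Tc by (subst hom_finprod[OF B C g]) (auto intro!: C.finprod_cong' simp: g.hom_int_pow)
    then have "g ?y = \<one>\<^bsub>C\<^esub>"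
      using c' pc sc by (simp add: g.hom_int_pow)
    then have "?y \<in> kernel B C g" using pc sc by (auto simp: kernel_def)
    then have "?y \<in> f ` carrier A" by (simp add: ex)
    then obtain a where "a \<in> carrier A" "f a = ?y" by (metis imageE)
    with \<open>c s \<noteq> 0\<close> show ?thesis by blast
  qed
  then obtain c a where c: "\<And>s. s \<in> S - T \<Longrightarrow> c s s \<noteq> (0::int)"
    and a: "\<And>s. s \<in> S - T \<Longrightarrow> a s \<in> carrier A"
    and fa: "\<And>s. s \<in> S - T \<Longrightarrow> f (a s) = s [^]\<^bsub>B\<^esub> c s s \<otimes>\<^bsub>B\<^esub> finprod B (\<lambda>t. t [^]\<^bsub>B\<^esub> c s t) T"
    by metis
  have "zind A a (S - T)"
    unfolding zind_def
  proof (intro conjI allI impI)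
    show "finite (S - T)" using fS by simp
    show "a \<in> S - T \<rightarrow> carrier A" using a by auto
    fix d :: "'y \<Rightarrow> int"
    assume d: "finprod A (\<lambda>x. a x [^]\<^bsub>A\<^esub> d x) (S - T) = \<one>\<^bsub>A\<^esub>"
    \<comment> \<open>In a combination of the elements \<open>f (a s)\<close> each \<open>s\<close>
      outside \<open>T\<close> keeps the coefficient \<open>c s s * d s\<close>; everything that
      falls on \<open>T\<close> is collected in one coefficient function \<open>e\<close>.\<close>
    have *: "\<exists>e::'y \<Rightarrow> int. finprod B (\<lambda>s. f (a s) [^]\<^bsub>B\<^esub> d s) U
       = finprod B (\<lambda>s. s [^]\<^bsub>B\<^esub> (c s s * d s)) U \<otimes>\<^bsub>B\<^esub> finprod B (\<lambda>t. t [^]\<^bsub>B\<^esub> e t) T"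
      if "finite U" "U \<subseteq> S - T" for U
      using that
    proof (induction U)
      case empty
      have "finprod B (\<lambda>t. t [^]\<^bsub>B\<^esub> (0::int)) T = \<one>\<^bsub>B\<^esub>" by (intro B.finprod_one_eqI) auto
      then show ?case by (intro exI[of _ "\<lambda>_. 0"]) auto
    next
      case (insert s U)
      then obtain e :: "'y \<Rightarrow> int" where e: "finprod B (\<lambda>s. f (a s) [^]\<^bsub>B\<^esub> d s) U
         = finprod B (\<lambda>s. s [^]\<^bsub>B\<^esub> (c s s * d s)) U \<otimes>\<^bsub>B\<^esub> finprod B (\<lambda>t. t [^]\<^bsub>B\<^esub> e t) T"
        by auto
      have sc: "s \<in> carrier B" and Uc: "U \<subseteq> carrier B" and sS: "s \<in> S - T" using insert Sc by auto
      have ac: "\<And>r. r \<in> insert s U \<Longrightarrow> a r \<in> carrier A" using a insert by blast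
      have 1: "f (a s) [^]\<^bsub>B\<^esub> d s = s [^]\<^bsub>B\<^esub> (c s s * d s) \<otimes>\<^bsub>B\<^esub> finprod B (\<lambda>t. t [^]\<^bsub>B\<^esub> (c s t * d s)) T"
        using Tc sc fa[OF sS] by (simp add: B.finprod_int_pow_mult B.int_pow_distrib B.int_pow_pow subset_iff Pi_iff)
      have 2: "finprod B (\<lambda>t. t [^]\<^bsub>B\<^esub> (c s t * d s + e t)) T
          = finprod B (\<lambda>t. t [^]\<^bsub>B\<^esub> (c s t * d s)) T \<otimes>\<^bsub>B\<^esub> finprod B (\<lambda>t. t [^]\<^bsub>B\<^esub> e t) T"
        using Tc by (intro B.finprod_int_pow_add) auto
      have cl: "finprod B (\<lambda>t. t [^]\<^bsub>B\<^esub> (k t :: int)) T \<in> carrier B"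
        "finprod B (\<lambda>t. t [^]\<^bsub>B\<^esub> (k t :: int)) U \<in> carrier B" for k
        using Tc Uc by (intro B.finprod_closed; auto)+
      have "finprod B (\<lambda>s. f (a s) [^]\<^bsub>B\<^esub> d s) (insert s U) = f (a s) [^]\<^bsub>B\<^esub> d s \<otimes>\<^bsub>B\<^esub> finprod B (\<lambda>s. f (a s) [^]\<^bsub>B\<^esub> d s) U"
        using insert a by (intro B.finprod_insert) auto
      moreover have "finprod B (\<lambda>s. s [^]\<^bsub>B\<^esub> (c s s * d s)) (insert s U)
          = s [^]\<^bsub>B\<^esub> (c s s * d s) \<otimes>\<^bsub>B\<^esub> finprod B (\<lambda>s. s [^]\<^bsub>B\<^esub> (c s s * d s)) U"
        using insert Uc sc by (intro B.finprod_insert) auto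
      ultimately show ?case
        using sc cl by (intro exI[of _ "\<lambda>t. c s t * d s + e t"]) (simp add: 1 2 e B.m_ac)
    qed
    obtain e :: "'y \<Rightarrow> int" where e: "finprod B (\<lambda>s. f (a s) [^]\<^bsub>B\<^esub> d s) (S - T)
       = finprod B (\<lambda>s. s [^]\<^bsub>B\<^esub> (c s s * d s)) (S - T) \<otimes>\<^bsub>B\<^esub> finprod B (\<lambda>t. t [^]\<^bsub>B\<^esub> e t) T"
      using *[of "S - T"] fS by auto
    have "finprod B (\<lambda>s. f (a s) [^]\<^bsub>B\<^esub> d s) (S - T) = f (finprod A (\<lambda>x. a x [^]\<^bsub>A\<^esub> d x) (S - T))"
      using a by (subst hom_finprod[OF A B f]) (auto intro!: B.finprod_cong' simp: f.hom_int_pow)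
    with d have one: "finprod B (\<lambda>s. f (a s) [^]\<^bsub>B\<^esub> d s) (S - T) = \<one>\<^bsub>B\<^esub>" by simp
    \<comment> \<open>A relation among the \<open>a s\<close> thus becomes a relation
      \<open>k\<close> on all of \<open>S\<close>. Independence of \<open>S\<close> gives
      \<open>c s s * d s = 0\<close>, and \<open>c s s\<close> is nonzero.\<close>
    define k where "k = (\<lambda>s. if s \<in> T then e s else c s s * d s)"
    have "finprod B (\<lambda>s. s [^]\<^bsub>B\<^esub> k s) ((S - T) \<union> T)
        = finprod B (\<lambda>s. s [^]\<^bsub>B\<^esub> k s) (S - T) \<otimes>\<^bsub>B\<^esub> finprod B (\<lambda>t. t [^]\<^bsub>B\<^esub> k t) T"
      using fS fT Sc Tc by (intro B.finprod_Un_disjoint) auto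
    also have "finprod B (\<lambda>s. s [^]\<^bsub>B\<^esub> k s) (S - T) = finprod B (\<lambda>s. s [^]\<^bsub>B\<^esub> (c s s * d s)) (S - T)"
      using Sc by (intro B.finprod_cong') (auto simp: k_def)
    also have "finprod B (\<lambda>t. t [^]\<^bsub>B\<^esub> k t) T = finprod B (\<lambda>t. t [^]\<^bsub>B\<^esub> e t) T"
      using Tc by (intro B.finprod_cong') (auto simp: k_def)
    finally have "finprod B (\<lambda>s. s [^]\<^bsub>B\<^esub> k s) ((S - T) \<union> T) = \<one>\<^bsub>B\<^esub>"
      using e one by simp
    moreover have "(S - T) \<union> T = S" using T by auto
    ultimately have "\<forall>s\<in>S. k s = 0" using S by (auto simp: zindep_def)
    with c show "\<forall>x\<in>S - T. d x = 0" by (force simp: k_def)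
  qed
  with T that show ?thesis by blast
qed

text \<open>Splitting gives the upper bound and gluing the lower one. The argument works with
  multiples instead of a section of \<open>g\<close>, so additivity also holds in the presence of
  torsion.\<close>

lemma grank_extension:
  assumes "finite_rank A" "finite_rank C"
  shows "finite_rank B" "grank B = grank A + grank C"
proof -
  have le: "card S \<le> grank A + grank C" if S: "zindep B S" for S
  proof -
    obtain T a where T: "T \<subseteq> S" "zind C g T" "zind A a (S - T)"
      using zindep_split[OF S] by blast
    have "finite S" using S by (simp add: zindep_def)
    then have "card S = card (S - T) + card T"
      using T(1) by (metis add.commute card_Diff_subset card_mono finite_subset le_add_diff_inverse)
    then show ?thesis
      using card_le_grank[OF A assms(1) T(3)] card_le_grank[OF C assms(2) T(2)] by linarith
  qed
  obtain SA where "zindep A SA" "card SA = grank A"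
    using grank_attained[OF A assms(1)] .
  moreover obtain SC where "zindep C SC" "card SC = grank C"
    using grank_attained[OF C assms(2)] .
  ultimately obtain U where U: "zindep B U" "card U = grank A + grank C"
    using zindep_glue by metis
  show "finite_rank B" "grank B = grank A + grank C"
    using grank_eqI[OF le U] by auto
qed

end

section \<open>Ranks of trivial, isomorphic and infinite cyclic groups\<close>

lemma grank_trivial_group:
  assumes "trivial_group G"
  shows "finite_rank G" "grank G = 0" "torsion_free G"
proof -
  interpret group G using assms by (simp add: trivial_group_def)
  have c: "carrier G = {\<one>\<^bsub>G\<^esub>}" using assms by (simp add: trivial_group_def)
  interpret comm_group G
    by (rule group_comm_groupI) (use c in auto)
  \<comment> \<open>The identity element is dependent by itself, through the coefficient 1.\<close>
  have "S = {}" if "zindep G S" for S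
  proof (rule ccontr)
    assume "S \<noteq> {}"
    with that c have "S = {\<one>\<^bsub>G\<^esub>}" by (auto simp: zindep_def)
    moreover have "finprod G (\<lambda>x. x [^]\<^bsub>G\<^esub> (1::int)) S = \<one>\<^bsub>G\<^esub>"
      using c \<open>S = {\<one>\<^bsub>G\<^esub>}\<close> by simp
    ultimately have "\<forall>x\<in>S. (1::int) = 0"
      using that unfolding zindep_def by (elim conjE) (erule allE[of _ "\<lambda>_. 1"], simp)
    then show False using \<open>S = {\<one>\<^bsub>G\<^esub>}\<close> by simp
  qed
  then show "finite_rank G" "grank G = 0"
    using grank_eqI[of G 0 "{}"] zindep_empty[of G] by force+
  show "torsion_free G" using c by (auto simp: torsion_free_def)
qed

text \<open>An isomorphism is a short exact sequence with trivial kernel term, so the two extension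
  results apply with a singleton group on the left.\<close>

lemma grank_iso:
  assumes "comm_group G" "comm_group H" "G \<cong> H" "finite_rank H"
  shows "finite_rank G" "grank G = grank H"
    and "torsion_free H \<Longrightarrow> torsion_free G"
proof -
  obtain h where h: "h \<in> iso G H" using assms by (auto simp: is_iso_def)
  interpret G: comm_group G by fact
  interpret H: comm_group H by fact
  let ?A = "singleton_group \<one>\<^bsub>G\<^esub>" and ?f = "id :: 'a \<Rightarrow> 'a"
  interpret h: group_hom G H h using h by (simp add: iso_def group_hom.intro group_hom_axioms.intro)
  have 1: "h \<in> hom G H" "h ` carrier G = carrier H" and inj: "inj_on h (carrier G)"
    using h by (auto simp: iso_def bij_betw_def)
  have 2: "?f \<in> hom ?A G" "inj_on ?f (carrier ?A)"
    by (auto simp: hom_def singleton_group_def)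
  have 3: "?f ` carrier ?A = kernel G H h"
    using inj h.inj_iff_trivial_ker by auto
  have triv: "trivial_group ?A" by simp
  note * = singleton_abelian_group assms(1,2) 2(1) 1(1) 2(2) 1(2) 3
  show "finite_rank G" "grank G = grank H"
    using grank_extension[OF *] grank_trivial_group[OF triv] assms(4) by auto
  show "torsion_free H \<Longrightarrow> torsion_free G"
    using torsion_free_extension[OF *] grank_trivial_group[OF triv] by auto
qed

lemma grank_integer_group:
  shows "finite_rank integer_group" "grank integer_group = 1" "torsion_free integer_group"
proof -
  interpret comm_group integer_group by (rule abelian_integer_group)
  have pw: "x [^]\<^bsub>integer_group\<^esub> c = c * x" for x c :: int by simp
  have "card S \<le> 1" if S: "zindep integer_group S" for S
  proof (rule ccontr)
    assume "\<not> card S \<le> 1"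
    moreover have "finite S" using S by (simp add: zindep_def)
    ultimately obtain x y where xy: "x \<in> S" "y \<in> S" "x \<noteq> y"
      by (auto simp: card_le_Suc0_iff_eq)
    \<comment> \<open>Two distinct integers satisfy the relation \<open>y * x - x * y = 0\<close>,
      which is nontrivial since they are not both 0.\<close>
    define c where "c = (\<lambda>z. if z = x then y else if z = y then -x else 0)"
    have "finprod integer_group (\<lambda>z. z [^]\<^bsub>integer_group\<^esub> c z) S
        = finprod integer_group (\<lambda>z. z [^]\<^bsub>integer_group\<^esub> c z) {x,y}"
      using xy S by (intro finprod_mono_neutral_cong_right) (auto simp: c_def zindep_def)
    also have "\<dots> = 0" using xy by (simp add: c_def)
    finally have "c x = 0 \<and> c y = 0" using S xy by (auto simp: zindep_def)
    with xy show False by (auto simp: c_def)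
  qed
  moreover have "zindep integer_group {1}" by (auto simp: zindep_def)
  ultimately show "finite_rank integer_group" "grank integer_group = 1"
    using grank_eqI[of integer_group 1 "{1}"] by auto
  show "torsion_free integer_group" by (auto simp: torsion_free_def)
qed

section \<open>The Thom isomorphism of a trivial bundle\<close>

text \<open>An equivalence, because the zigzags of isomorphisms below are traversed both along and
  against their arrows.\<close>

lemma iso_square_surj:
  assumes "\<alpha> \<in> iso G H" "\<beta> \<in> iso G' H'" "g \<in> hom G G'"
    and "\<And>x. x \<in> carrier G \<Longrightarrow> h (\<alpha> x) = \<beta> (g x)"
  shows "g ` carrier G = carrier G' \<longleftrightarrow> h ` carrier H = carrier H'"
proof -
  have a: "carrier H = \<alpha> ` carrier G" and b: "carrier H' = \<beta> ` carrier G'" "inj_on \<beta> (carrier G')"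
    using assms(1,2) by (auto simp: iso_def bij_betw_def)
  have sub: "g ` carrier G \<subseteq> carrier G'" using assms(3) by (auto simp: hom_def)
  have "h ` carrier H = \<beta> ` g ` carrier G"
    using assms(4) by (auto simp: a image_iff)
  then show ?thesis
    using inj_on_image_eq_iff[OF b(2) sub order_refl] b(1) by metis
qed

text \<open>The excised set is the complement of \<open>V\<close>. It is closed, and the covering
  condition places it inside \<open>T\<close>, which is its own interior.\<close>

lemma excision_open:
  assumes "openin X V" "openin X T" "topspace X \<subseteq> V \<union> T"
  shows "hom_induced p (subtopology X V) (T \<inter> V) X T id
    \<in> iso (relative_homology_group p (subtopology X V) (T \<inter> V)) (relative_homology_group p X T)"
proof -
  have "X closure_of (topspace X - V) = topspace X - V"
    using assms(1) by (simp add: closedin_def closure_of_closedin openin_subset double_diff)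
  moreover have "X interior_of T = T"
    using assms(2) by (simp add: interior_of_openin)
  moreover have T: "T \<subseteq> topspace X" "V \<subseteq> topspace X"
    using assms(1,2) by (auto simp: openin_subset)
  ultimately have "hom_induced p (subtopology X (topspace X - (topspace X - V))) (T - (topspace X - V)) (subtopology X (topspace X)) T id
    \<in> iso (relative_homology_group p (subtopology X (topspace X - (topspace X - V))) (T - (topspace X - V)))
          (relative_homology_group p (subtopology X (topspace X)) T)"
    using assms(3) by (intro homology_excision_axiom) auto
  moreover have "topspace X - (topspace X - V) = V" "T - (topspace X - V) = T \<inter> V"
    using T by auto
  ultimately show ?thesis by simp
qed

text \<open>The identity of the pair is homotopic, through maps preserving \<open>S\<close>, to a
  map that factors through the pair of \<open>S\<close> with itself, whose homology
  vanishes.\<close>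

lemma trivial_relative_homology_compression:
  assumes hom: "homotopic_with (\<lambda>h. h \<in> S \<rightarrow> S) X X id g" and g: "g \<in> topspace X \<rightarrow> S"
  shows "trivial_group (relative_homology_group p X S)"
proof -
  have cg: "continuous_map X X g"
    using hom homotopic_with_imp_continuous_maps by blast
  then have cg': "continuous_map X (subtopology X S) g"
    using g by (simp add: continuous_map_in_subtopology image_subset_iff_funcset)
  have gS: "g \<in> S \<rightarrow> S"
    using hom homotopic_with_imp_property by blast
  have triv: "trivial_group (relative_homology_group p (subtopology X S) S)"
    using trivial_relative_homology_group_topspace [of p "subtopology X S"]
    by (metis inf_right_idem relative_homology_group_restrict topspace_subtopology)
  interpret i: group_hom "relative_homology_group p (subtopology X S) S" "relative_homology_group p X S"
      "hom_induced p (subtopology X S) S X S id"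
    by (simp add: group_hom.intro group_hom_axioms.intro hom_induced_hom)
  have "c = \<one>\<^bsub>relative_homology_group p X S\<^esub>" if c: "c \<in> carrier (relative_homology_group p X S)" for c
  proof -
    have "c = hom_induced p X S X S g c"
      using homology_homotopy_axiom[OF hom] hom_induced_id[OF c] by simp
    also have "\<dots> = hom_induced p (subtopology X S) S X S id (hom_induced p X S (subtopology X S) S g c)"
      using cg' gS by (simp add: hom_induced_compose')
    also have "hom_induced p X S (subtopology X S) S g c \<in> carrier (relative_homology_group p (subtopology X S) S)"
      by (rule hom_induced_carrier)
    then have "hom_induced p X S (subtopology X S) S g c = \<one>\<^bsub>relative_homology_group p (subtopology X S) S\<^esub>"
      using triv by (simp add: trivial_group_def)
    finally show ?thesis by (simp only: i.hom_one)
  qed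
  moreover have "\<one>\<^bsub>relative_homology_group p X S\<^esub> \<in> carrier (relative_homology_group p X S)"
    by (rule i.H.one_closed)
  ultimately show ?thesis
    by (auto simp: trivial_group_def)
qed

text \<open>In the exact sequence of the triple both neighbours are homology groups of
  \<open>X\<close> relative to \<open>S\<close>, and these vanish.\<close>

lemma iso_relative_homology_inclusion:
  assumes "T \<subseteq> S" "\<And>q. trivial_group (relative_homology_group q X S)"
  shows "hom_induced p (subtopology X S) T X T id
    \<in> iso (relative_homology_group p (subtopology X S) T) (relative_homology_group p X T)"
proof (rule very_short_exact_sequence)
  show "exact_seq ([relative_homology_group p X S, relative_homology_group p X T,
      relative_homology_group p (subtopology X S) T, relative_homology_group (p + 1) X S],
    [hom_induced p X T X S id, hom_induced p (subtopology X S) T X T id, hom_relboundary (p + 1) X S T])"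
    using homology_exactness_triple_2[OF assms(1), of "p + 1" X] homology_exactness_triple_3[OF assms(1), of p X]
    by simp
qed (use assms in auto)

text \<open>The same sequence, now with the groups of \<open>X\<close> relative to \<open>T\<close>
  vanishing, so that the connecting map is the isomorphism.\<close>

lemma iso_hom_relboundary_trivial:
  assumes "T \<subseteq> S" "\<And>q. trivial_group (relative_homology_group q X T)"
  shows "hom_relboundary (p + 1) X S T
    \<in> iso (relative_homology_group (p + 1) X S) (relative_homology_group p (subtopology X S) T)"
proof (rule very_short_exact_sequence)
  show "exact_seq ([relative_homology_group p X T, relative_homology_group p (subtopology X S) T,
      relative_homology_group (p + 1) X S, relative_homology_group (p + 1) X T],
    [hom_induced p (subtopology X S) T X T id, hom_relboundary (p + 1) X S T, hom_induced (p + 1) X T X S id])"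
    using homology_exactness_triple_1[OF assms(1), of "p + 1" X] homology_exactness_triple_2[OF assms(1), of "p + 1" X]
    by simp
qed (use assms in auto)

text \<open>The suspension isomorphism of a triad as the zigzag
  H(X, A u B) -> H(A u B, B) <- H(A, A n B) -> H(X, A n B).\<close>

lemma triad_zigzag:
  assumes "openin X A" "openin X B"
    and "\<And>q. trivial_group (relative_homology_group q X A)" "\<And>q. trivial_group (relative_homology_group q X B)"
  shows "hom_relboundary (p + 1) X (A \<union> B) B
      \<in> iso (relative_homology_group (p + 1) X (A \<union> B)) (relative_homology_group p (subtopology X (A \<union> B)) B)"
    and "hom_induced p (subtopology X A) (A \<inter> B) (subtopology X (A \<union> B)) B id
      \<in> iso (relative_homology_group p (subtopology X A) (A \<inter> B)) (relative_homology_group p (subtopology X (A \<union> B)) B)"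
    and "hom_induced p (subtopology X A) (A \<inter> B) X (A \<inter> B) id
      \<in> iso (relative_homology_group p (subtopology X A) (A \<inter> B)) (relative_homology_group p X (A \<inter> B))"
proof -
  show "hom_relboundary (p + 1) X (A \<union> B) B
      \<in> iso (relative_homology_group (p + 1) X (A \<union> B)) (relative_homology_group p (subtopology X (A \<union> B)) B)"
    using assms by (intro iso_hom_relboundary_trivial) auto
  show "hom_induced p (subtopology X A) (A \<inter> B) X (A \<inter> B) id
      \<in> iso (relative_homology_group p (subtopology X A) (A \<inter> B)) (relative_homology_group p X (A \<inter> B))"
    using assms by (intro iso_relative_homology_inclusion) auto
  have "openin (subtopology X (A \<union> B)) A" "openin (subtopology X (A \<union> B)) B"
    using assms by (auto simp: openin_open_subtopology openin_Un)
  from excision_open[OF this, of p]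
  show "hom_induced p (subtopology X A) (A \<inter> B) (subtopology X (A \<union> B)) B id
      \<in> iso (relative_homology_group p (subtopology X A) (A \<inter> B)) (relative_homology_group p (subtopology X (A \<union> B)) B)"
    by (simp add: subtopology_subtopology Int_commute Int_absorb1)
qed

lemma triad_suspension_iso:
  assumes "openin X A" "openin X B"
    and "\<And>q. trivial_group (relative_homology_group q X A)" "\<And>q. trivial_group (relative_homology_group q X B)"
  shows "relative_homology_group (p + 1) X (A \<union> B) \<cong> relative_homology_group p X (A \<inter> B)"
  using triad_zigzag[OF assms, of p] by (meson group.iso_sym group_relative_homology_group is_isoI iso_trans)

text \<open>All three maps of the zigzag are natural in the triad, so surjectivity passes from one
  end to the other. The abstract isomorphism of the two ends would not carry this
  information.\<close>

lemma triad_suspension_surj: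
  assumes X: "openin X A" "openin X B"
    "\<And>q. trivial_group (relative_homology_group q X A)" "\<And>q. trivial_group (relative_homology_group q X B)"
    and Y: "openin Y A'" "openin Y B'"
    "\<And>q. trivial_group (relative_homology_group q Y A')" "\<And>q. trivial_group (relative_homology_group q Y B')"
    and f: "continuous_map X Y f" "f \<in> A \<rightarrow> A'" "f \<in> B \<rightarrow> B'"
    and surj: "hom_induced p X (A \<inter> B) Y (A' \<inter> B') f ` carrier (relative_homology_group p X (A \<inter> B))
      = carrier (relative_homology_group p Y (A' \<inter> B'))"
  shows "hom_induced (p + 1) X (A \<union> B) Y (A' \<union> B') f ` carrier (relative_homology_group (p + 1) X (A \<union> B))
      = carrier (relative_homology_group (p + 1) Y (A' \<union> B'))"
proof -
  note zX = triad_zigzag[OF X, of p] and zY = triad_zigzag[OF Y, of p]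
  have fAB: "f \<in> A \<union> B \<rightarrow> A' \<union> B'" "f \<in> A \<inter> B \<rightarrow> A' \<inter> B'"
    using f by auto
  have cA: "continuous_map (subtopology X A) (subtopology Y A') f"
    and cAB: "continuous_map (subtopology X (A \<union> B)) (subtopology Y (A' \<union> B')) f"
    using f by (auto simp: continuous_map_in_subtopology continuous_map_from_subtopology)
  have iA: "continuous_map (subtopology X A) (subtopology X (A \<union> B)) id"
    "continuous_map (subtopology Y A') (subtopology Y (A' \<union> B')) id"
    by (auto simp: continuous_map_in_subtopology continuous_map_from_subtopology)
  have 1: "hom_induced p X (A \<inter> B) Y (A' \<inter> B') f (hom_induced p (subtopology X A) (A \<inter> B) X (A \<inter> B) id x)
     = hom_induced p (subtopology Y A') (A' \<inter> B') Y (A' \<inter> B') id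
        (hom_induced p (subtopology X A) (A \<inter> B) (subtopology Y A') (A' \<inter> B') f x)" for x
    using f fAB cA by (simp add: hom_induced_compose')
  have 2: "hom_induced p (subtopology X (A \<union> B)) B (subtopology Y (A' \<union> B')) B' f
       (hom_induced p (subtopology X A) (A \<inter> B) (subtopology X (A \<union> B)) B id x)
     = hom_induced p (subtopology Y A') (A' \<inter> B') (subtopology Y (A' \<union> B')) B' id
        (hom_induced p (subtopology X A) (A \<inter> B) (subtopology Y A') (A' \<inter> B') f x)" for x
    using f fAB cA cAB iA by (simp add: hom_induced_compose')
  have 3: "hom_induced p (subtopology X (A \<union> B)) B (subtopology Y (A' \<union> B')) B' f
       (hom_relboundary (p + 1) X (A \<union> B) B x)
     = hom_relboundary (p + 1) Y (A' \<union> B') B' (hom_induced (p + 1) X (A \<union> B) Y (A' \<union> B') f x)" for x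
    using fun_cong[OF naturality_hom_induced_relboundary[OF f(1) fAB(1) f(3), of "p + 1"], of x]
    by simp
  have "hom_induced p (subtopology X A) (A \<inter> B) (subtopology Y A') (A' \<inter> B') f
      ` carrier (relative_homology_group p (subtopology X A) (A \<inter> B))
      = carrier (relative_homology_group p (subtopology Y A') (A' \<inter> B'))"
    by (rule iffD2[OF iso_square_surj[OF zX(3) zY(3) hom_induced_hom 1] surj])
  note iffD1[OF iso_square_surj[OF zX(2) zY(2) hom_induced_hom 2] this]
  then show ?thesis
    by (rule iffD2[OF iso_square_surj[OF zX(1) zY(1) hom_induced_hom 3]])
qed

section \<open>Products with a Euclidean fibre, one coordinate at a time\<close>

lemma continuous_map_scaleR:
  fixes g :: "'a \<Rightarrow> 'b::real_normed_vector"
  assumes "continuous_map X euclideanreal f" "continuous_map X euclidean g"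
  shows "continuous_map X euclidean (\<lambda>x. f x *\<^sub>R g x)"
  using assms by (simp add: continuous_map_atin tendsto_scaleR)

text \<open>The set \<open>U\<close> is star-shaped about \<open>b\<close>. With
  \<open>U = UNIV\<close> this gives homotopy invariance of the product; with \<open>U\<close> a
  half below it shows that a relative group is trivial.\<close>

lemma homotopic_with_fibre_contraction:
  fixes U :: "'b::real_normed_vector set"
  assumes "\<And>y t. y \<in> U \<Longrightarrow> 0 \<le> t \<Longrightarrow> t \<le> 1 \<Longrightarrow> (1 - t) *\<^sub>R y + t *\<^sub>R b \<in> U"
  shows "homotopic_with (\<lambda>h. h \<in> topspace X \<times> U \<rightarrow> topspace X \<times> U)
    (prod_topology X euclidean) (prod_topology X euclidean) id (\<lambda>(x, y). (x, b))"
proof -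
  let ?P = "prod_topology X (euclidean :: 'b topology)"
  let ?h = "\<lambda>(t::real, (x, y)). (x, (1 - t) *\<^sub>R y + t *\<^sub>R b)"
  have "continuous_map (prod_topology (top_of_set {0..1}) ?P) ?P ?h"
  proof -
    have t: "continuous_map (prod_topology (top_of_set {0..1}) ?P) euclideanreal fst"
      using continuous_map_fst[of "top_of_set {0..1::real}" ?P] continuous_map_into_fulltopology by blast
    have "continuous_map (prod_topology (top_of_set {0..1}) ?P) ?P
        (\<lambda>z. (fst (snd z), (1 - fst z) *\<^sub>R snd (snd z) + fst z *\<^sub>R b))"
      by (intro continuous_map_pairedI continuous_map_add continuous_map_scaleR continuous_map_diff t
          continuous_map_const[THEN iffD2] continuous_map_compose[OF continuous_map_snd continuous_map_fst, unfolded o_def]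
          continuous_map_compose[OF continuous_map_snd continuous_map_snd, unfolded o_def]) auto
    then show ?thesis by (simp add: case_prod_beta')
  qed
  then show ?thesis
    unfolding homotopic_with_def
    using assms by (intro exI[of _ ?h]) (auto simp: fun_eq_iff)
qed

lemma homology_prod_fst_iso:
  fixes X :: "'a topology"
  shows "hom_induced p (prod_topology X (euclidean :: 'b::real_normed_vector topology)) {} X {} fst
    \<in> iso (homology_group p (prod_topology X (euclidean :: 'b topology))) (homology_group p X)"
proof (rule homotopy_equivalence_homology_group_isomorphism)
  let ?P = "prod_topology X (euclidean :: 'b topology)"
  show "continuous_map ?P X fst" by (rule continuous_map_fst)
  show "continuous_map X ?P (\<lambda>x. (x, 0))"
    by (intro continuous_map_pairedI) auto
  have "homotopic_with (\<lambda>h. h \<in> topspace X \<times> UNIV \<rightarrow> topspace X \<times> UNIV) ?P ?P id (\<lambda>(x, y). (x, 0))"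
    by (rule homotopic_with_fibre_contraction) auto
  then have "homotopic_with (\<lambda>_. True) ?P ?P id (\<lambda>(x, y). (x, 0))"
    by (rule homotopic_with_mono) auto
  then show "homotopic_with (\<lambda>_. True) ?P ?P ((\<lambda>x. (x, 0)) \<circ> fst) id"
    by (subst homotopic_with_sym) (simp add: o_def case_prod_beta')
  show "homotopic_with (\<lambda>_. True) X X (fst \<circ> (\<lambda>x. (x, 0 :: 'b))) id"
    by (simp add: o_def id_def)
qed

text \<open>The complement of the subspace orthogonal to \<open>D\<close>. As \<open>D\<close> grows
  from \<open>{}\<close> to \<open>Basis\<close>, it grows from the empty set to the space without
  the origin, one suspension for each coordinate.\<close>

abbreviation off_axes :: "'b::real_inner set \<Rightarrow> 'b set" where
  "off_axes D \<equiv> {y. \<exists>d\<in>D. y \<bullet> d \<noteq> 0}"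

context
  fixes D :: "'b::euclidean_space set" and b :: 'b
  assumes D: "D \<subseteq> Basis" "b \<in> Basis" "b \<notin> D"
begin

text \<open>The complement of a closed half-space, \<open>s * (y \<bullet> b) \<le> 0\<close>,
  inside the subspace orthogonal to \<open>D\<close>. The signs \<open>s = 1\<close> and
  \<open>s = -1\<close> give the two members of the triad that adds the coordinate
  \<open>b\<close>.\<close>

abbreviation half :: "real \<Rightarrow> 'b set" where
  "half s \<equiv> off_axes D \<union> {y. s * (y \<bullet> b) > 0}"

lemma half_Un: "half 1 \<union> half (-1) = off_axes (insert b D)"
  by (auto simp: linorder_neq_iff)

lemma half_Int: "half 1 \<inter> half (-1) = off_axes D"
  by auto

lemma open_half: "open (half s)"
proof -
  have "open (\<Union>d\<in>D. {y. y \<bullet> d \<noteq> 0})"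
    by (intro open_UN ballI open_Collect_neq continuous_intros)
  also have "(\<Union>d\<in>D. {y. y \<bullet> d \<noteq> 0}) = off_axes D" by auto
  finally show ?thesis
    by (intro open_Un open_Collect_less continuous_intros)
qed

text \<open>Since \<open>b\<close> is orthogonal to \<open>D\<close>, moving towards
  \<open>s *\<^sub>R b\<close> only rescales the coordinates in \<open>D\<close> by
  \<open>1 - t\<close> and pushes the coordinate along \<open>b\<close> to the side of
  \<open>s\<close>. At \<open>t = 1\<close> the end point itself lies on that side.\<close>

lemma half_star_shaped:
  assumes "s \<noteq> 0" "y \<in> half s" "0 \<le> t" "t \<le> 1"
  shows "(1 - t) *\<^sub>R y + t *\<^sub>R (s *\<^sub>R b) \<in> half s"
proof -
  let ?z = "(1 - t) *\<^sub>R y + t *\<^sub>R (s *\<^sub>R b)"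
  have bb: "b \<bullet> b = 1" and bd: "\<And>d. d \<in> D \<Longrightarrow> b \<bullet> d = 0"
    using D by (auto simp: inner_Basis subset_iff)
  have zb: "s * (?z \<bullet> b) = (1 - t) * (s * (y \<bullet> b)) + t * s\<^sup>2"
    by (simp add: inner_add_left bb algebra_simps power2_eq_square)
  have s2: "s\<^sup>2 > 0" using assms(1) by simp
  consider "t = 1" | "t < 1" "\<exists>d\<in>D. y \<bullet> d \<noteq> 0" | "t < 1" "s * (y \<bullet> b) > 0"
    using assms by fastforce
  then show ?thesis
  proof cases
    case 1
    then show ?thesis using zb s2 by auto
  next
    case 2
    then obtain d where "d \<in> D" "y \<bullet> d \<noteq> 0" by auto
    then have "?z \<bullet> d \<noteq> 0" using 2 bd by (simp add: inner_add_left)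
    with \<open>d \<in> D\<close> show ?thesis by auto
  next
    case 3
    have "(1 - t) * (s * (y \<bullet> b)) > 0"
      by (rule mult_pos_pos[OF _ 3(2)]) (use 3 in simp)
    moreover have "t * s\<^sup>2 \<ge> 0"
      using assms(3) by simp
    ultimately have "s * (?z \<bullet> b) > 0" unfolding zb by linarith
    then show ?thesis by auto
  qed
qed

lemma half_product:
  assumes "s \<noteq> 0"
  shows "openin (prod_topology X euclidean) (topspace X \<times> half s)"
    and "trivial_group (relative_homology_group q (prod_topology X euclidean) (topspace X \<times> half s))"
proof -
  show "openin (prod_topology X euclidean) (topspace X \<times> half s)"
    using open_half by (simp add: openin_prod_Times_iff)
  show "trivial_group (relative_homology_group q (prod_topology X euclidean) (topspace X \<times> half s))"
  proof (rule trivial_relative_homology_compression)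
    show "homotopic_with (\<lambda>h. h \<in> topspace X \<times> half s \<rightarrow> topspace X \<times> half s)
       (prod_topology X euclidean) (prod_topology X euclidean) id (\<lambda>(x, y). (x, s *\<^sub>R b))"
      using half_star_shaped[OF assms] by (rule homotopic_with_fibre_contraction)
    have "s * (s *\<^sub>R b \<bullet> b) > 0"
      using assms D(2) by (simp add: inner_Basis flip: power2_eq_square)
    then show "(\<lambda>(x, y). (x, s *\<^sub>R b)) \<in> topspace (prod_topology X euclidean) \<rightarrow> topspace X \<times> half s"
      by auto
  qed
qed

text \<open>The two halves unite to the larger \<open>off_axes\<close> and meet in the smaller one,
  which is exactly the input of the triad suspension.\<close>

lemma thom_step_iso:
  "relative_homology_group (p + 1) (prod_topology X euclidean) (topspace X \<times> off_axes (insert b D))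
   \<cong> relative_homology_group p (prod_topology X euclidean) (topspace X \<times> off_axes D)"
  using triad_suspension_iso[OF half_product(1)[of 1 X] half_product(1)[of "-1" X]
    half_product(2)[of 1 _ X] half_product(2)[of "-1" _ X], of p]
  unfolding Times_Int_Times Sigma_Un_distrib2[symmetric] half_Un half_Int by simp

lemma thom_step_surj:
  assumes f: "continuous_map X Y f"
    and "hom_induced p (prod_topology X euclidean) (topspace X \<times> off_axes D)
          (prod_topology Y euclidean) (topspace Y \<times> off_axes D) (map_prod f id)
        ` carrier (relative_homology_group p (prod_topology X euclidean) (topspace X \<times> off_axes D))
        = carrier (relative_homology_group p (prod_topology Y euclidean) (topspace Y \<times> off_axes D))"
  shows "hom_induced (p + 1) (prod_topology X euclidean) (topspace X \<times> off_axes (insert b D))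
          (prod_topology Y euclidean) (topspace Y \<times> off_axes (insert b D)) (map_prod f id)
        ` carrier (relative_homology_group (p + 1) (prod_topology X euclidean) (topspace X \<times> off_axes (insert b D)))
        = carrier (relative_homology_group (p + 1) (prod_topology Y euclidean) (topspace Y \<times> off_axes (insert b D)))"
proof -
  have c: "continuous_map (prod_topology X (euclidean :: 'b topology)) (prod_topology Y euclidean) (map_prod f id)"
    using f by (simp add: map_prod_def continuous_map_prod_top)
  have m: "map_prod f id \<in> topspace X \<times> half s \<rightarrow> topspace Y \<times> half s" for s
    using continuous_map_funspace[OF f] by auto
  show ?thesis
    using triad_suspension_surj[OF half_product(1)[of 1 X] half_product(1)[of "-1" X]
      half_product(2)[of 1 _ X] half_product(2)[of "-1" _ X]
      half_product(1)[of 1 Y] half_product(1)[of "-1" Y]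
      half_product(2)[of 1 _ Y] half_product(2)[of "-1" _ Y] c m m, of p] assms(2)
    unfolding Times_Int_Times Sigma_Un_distrib2[symmetric] half_Un half_Int by simp
qed

end

text \<open>For empty \<open>D\<close> the relative group is the absolute group of the product and
  the projection identifies it with that of \<open>X\<close>; each basis vector then raises the
  degree by one. Surjectivity runs along the same induction, with the map acting on the base
  only.\<close>

lemma thom_coordinates:
  fixes D :: "'b::euclidean_space set"
  assumes "finite D" "D \<subseteq> Basis"
  shows "relative_homology_group (p + int (card D)) (prod_topology X euclidean) (topspace X \<times> off_axes D)
      \<cong> homology_group p X"
    and "continuous_map X Y f \<Longrightarrow> hom_induced p X {} Y {} f ` carrier (homology_group p X) = carrier (homology_group p Y) \<Longrightarrow>
      hom_induced (p + int (card D)) (prod_topology X euclidean) (topspace X \<times> off_axes D)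
          (prod_topology Y euclidean) (topspace Y \<times> off_axes D) (map_prod f id)
        ` carrier (relative_homology_group (p + int (card D)) (prod_topology X euclidean) (topspace X \<times> off_axes D))
        = carrier (relative_homology_group (p + int (card D)) (prod_topology Y euclidean) (topspace Y \<times> off_axes D))"
  using assms
proof (induction D)
  case empty
  {
    case 1
    show ?case
      using homology_prod_fst_iso[of p X, where 'b='b] by (simp add: is_isoI)
  next
    case 2
    let ?F = "map_prod f id :: 'a \<times> 'b \<Rightarrow> 'c \<times> 'b"
    let ?PX = "prod_topology X (euclidean :: 'b topology)" and ?PY = "prod_topology Y (euclidean :: 'b topology)"
    have c: "continuous_map ?PX ?PY ?F"
      using 2(1) by (simp add: map_prod_def continuous_map_prod_top)
    have "hom_induced p X {} Y {} f (hom_induced p ?PX {} X {} fst x)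
        = hom_induced p ?PY {} Y {} fst (hom_induced p ?PX {} ?PY {} ?F x)" for x
      using 2(1) c by (simp add: hom_induced_compose' continuous_map_fst o_def)
    from iso_square_surj[OF homology_prod_fst_iso homology_prod_fst_iso hom_induced_hom this] 2(2)
    show ?case by (simp add: id_def)
  }
next
  case (insert b D)
  have c: "p + int (card (insert b D)) = p + int (card D) + 1"
    using insert by simp
  {
    case 1
    then have D: "D \<subseteq> Basis" "b \<in> Basis" "b \<notin> D" "D \<subseteq> Basis"
      using insert by auto
    show ?case
      unfolding c using iso_trans[OF thom_step_iso[OF D(1-3)] insert.IH(1)[OF D(4)]] .
  next
    case 2
    then have D: "D \<subseteq> Basis" "b \<in> Basis" "b \<notin> D" "D \<subseteq> Basis"
      using insert by auto
    show ?case
      unfolding c using thom_step_surj[OF D(1-3) 2(1) insert.IH(2)[OF 2(1,2) D(4)]] .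
  }
qed

lemma off_axes_Basis: "off_axes (Basis :: 'b::euclidean_space set) = - {0}"
  using euclidean_all_zero_iff by blast

theorem thom_iso:
  "relative_homology_group (p + int DIM('b)) (prod_topology X (euclidean :: 'b::euclidean_space topology)) (topspace X \<times> (- {0}))
      \<cong> homology_group p X"
  using thom_coordinates(1)[of "Basis :: 'b set" p X]
  by (simp add: off_axes_Basis)

theorem thom_surj:
  assumes "continuous_map X Y f" "hom_induced p X {} Y {} f ` carrier (homology_group p X) = carrier (homology_group p Y)"
  shows "hom_induced (p + int DIM('b)) (prod_topology X (euclidean :: 'b::euclidean_space topology)) (topspace X \<times> (- {0}))
          (prod_topology Y euclidean) (topspace Y \<times> (- {0})) (map_prod f id)
        ` carrier (relative_homology_group (p + int DIM('b)) (prod_topology X (euclidean :: 'b topology)) (topspace X \<times> (- {0})))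
        = carrier (relative_homology_group (p + int DIM('b)) (prod_topology Y (euclidean :: 'b topology)) (topspace Y \<times> (- {0})))"
  using thom_coordinates(2)[of "Basis :: 'b set" X Y f p] assms
  by (simp add: off_axes_Basis)

section \<open>Configuration spaces with pinned vertices\<close>

text \<open>Vertices in V are free and every other vertex i sits at q i. Thus obstacles are pinned vertices,
  and V = \<open>{1..M}\<close> gives the configuration space of a graph.\<close>

definition pinned :: "'i set \<Rightarrow> ('i \<Rightarrow> 'a) \<Rightarrow> ('i \<Rightarrow> 'a) \<Rightarrow> 'i \<Rightarrow> 'a" where
  "pinned V q x i = (if i \<in> V then x i else q i)"

definition confs :: "'i set \<Rightarrow> ('i \<Rightarrow> 'a) \<Rightarrow> 'i set set \<Rightarrow> ('i \<Rightarrow> 'a) set" where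
  "confs V q E = {x \<in> extensional V. \<forall>i j. {i, j} \<in> E \<longrightarrow> pinned V q x i \<noteq> pinned V q x j}"

abbreviation (input) power_space :: "'i set \<Rightarrow> ('i \<Rightarrow> 'a::topological_space) topology" where
  "power_space V \<equiv> product_topology (\<lambda>_. euclidean) V"

definition conf_space :: "'i set \<Rightarrow> ('i \<Rightarrow> 'a::topological_space) \<Rightarrow> 'i set set \<Rightarrow> ('i \<Rightarrow> 'a) topology" where
  "conf_space V q E = subtopology (power_space V) (confs V q E)"

definition graph_on :: "'i set \<Rightarrow> 'i set \<Rightarrow> 'i set set \<Rightarrow> bool" where
  "graph_on V R E \<longleftrightarrow> finite V \<and> finite R \<and> V \<inter> R = {} \<and> (\<forall>e\<in>E. e \<subseteq> V \<union> R \<and> card e = 2)"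

definition merge_vertex :: "'i \<Rightarrow> 'i \<Rightarrow> 'i \<Rightarrow> 'i" where
  "merge_vertex k j i = (if i = k then j else i)"

text \<open>The vertex \<open>k\<close> is absorbed by \<open>j\<close>. Edges are sets, so parallel
  edges merge by themselves, and contraction may lose more than one edge.\<close>

definition contract :: "'i \<Rightarrow> 'i \<Rightarrow> 'i set set \<Rightarrow> 'i set set" where
  "contract k j E = (\<lambda>e. merge_vertex k j ` e) ` (E - {{k, j}})"

lemma topspace_power_space [simp]: "topspace (power_space V) = extensional V"
  by (auto simp: PiE_def)

lemma confs_mono: "E \<subseteq> E' \<Longrightarrow> confs V q E' \<subseteq> confs V q E"
  by (auto simp: confs_def)

lemma confs_extensional: "confs V q E \<subseteq> extensional V"
  by (auto simp: confs_def)

lemma topspace_conf_space [simp]: "topspace (conf_space V q E) = confs V q E"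
  unfolding conf_space_def topspace_subtopology topspace_power_space by (auto simp: confs_def)

lemma conf_space_subtopology:
  "confs V q E' \<subseteq> confs V q E \<Longrightarrow> subtopology (conf_space V q E) (confs V q E') = conf_space V q E'"
  by (simp add: conf_space_def subtopology_subtopology Int_absorb1)

lemma continuous_map_conf_space_id:
  "confs V q E' \<subseteq> confs V q E \<Longrightarrow> continuous_map (conf_space V q E') (conf_space V q E) id"
  by (simp add: conf_space_def continuous_map_in_subtopology continuous_map_from_subtopology) auto

lemma graph_on_finite: "graph_on V R E \<Longrightarrow> finite E"
  by (rule finite_subset[of E "Pow (V \<union> R)"]) (auto simp: graph_on_def)

lemma graph_on_subset: "graph_on V R E' \<Longrightarrow> E \<subseteq> E' \<Longrightarrow> graph_on V R E"
  by (auto simp: graph_on_def)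

text \<open>Merging identifies only \<open>k\<close> with \<open>j\<close>, so it is injective on
  every other edge and creates no loops.\<close>

lemma merge_image_edge:
  assumes "card e = 2" "e \<noteq> {k, j}" "k \<noteq> j"
  shows "card (merge_vertex k j ` e) = 2"
proof -
  have "inj_on (merge_vertex k j) e"
    using assms by (auto simp: inj_on_def merge_vertex_def card_2_iff split: if_splits)
  then show ?thesis using assms by (simp add: card_image)
qed

lemma graph_on_contract:
  assumes "graph_on V R E" "k \<in> V" "j \<noteq> k" "{k, j} \<in> E"
  shows "graph_on (V - {k}) R (contract k j E)"
proof -
  have j: "j \<in> V \<union> R" using assms by (auto simp: graph_on_def)
  have "merge_vertex k j ` e \<subseteq> (V - {k}) \<union> R \<and> card (merge_vertex k j ` e) = 2" if "e \<in> E - {{k,j}}" for e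
  proof
    have "e \<subseteq> V \<union> R" using that assms by (auto simp: graph_on_def)
    with j assms show "merge_vertex k j ` e \<subseteq> (V - {k}) \<union> R" by (auto simp: merge_vertex_def graph_on_def)
    show "card (merge_vertex k j ` e) = 2"
      using that assms by (intro merge_image_edge) (auto simp: graph_on_def)
  qed
  then show ?thesis using assms by (auto simp: graph_on_def contract_def)
qed

lemma contract_mono: "E \<subseteq> E' \<Longrightarrow> contract k j E \<subseteq> contract k j E'"
  by (auto simp: contract_def)

text \<open>The measure is the number of edges, which deletion and contraction both lower;
  \<open>V\<close> shrinks under contraction while \<open>R\<close> stays fixed. The recursion ends
  when all remaining edges join pinned vertices, rather than when no edges remain.\<close>

lemma graph_deletion_contraction_induct [consumes 1, case_names base step]:
  assumes "graph_on V R E"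
    and "\<And>V E. graph_on V R E \<Longrightarrow> (\<And>e. e \<in> E \<Longrightarrow> e \<inter> V = {}) \<Longrightarrow> P V E"
    and "\<And>V E k j. graph_on V R E \<Longrightarrow> k \<in> V \<Longrightarrow> j \<noteq> k \<Longrightarrow> {k, j} \<in> E \<Longrightarrow>
      P V (E - {{k, j}}) \<Longrightarrow> P (V - {k}) (contract k j E) \<Longrightarrow> P V E"
  shows "P V E"
  using assms(1)
proof (induction "card E" arbitrary: V E rule: less_induct)
  case less
  show ?case
  proof (cases "\<exists>e\<in>E. e \<inter> V \<noteq> {}")
    case False
    then show ?thesis using less.prems by (intro assms(2)) auto
  next
    case True
    then obtain e k where e: "e \<in> E" "k \<in> e" "k \<in> V" by auto
    have "card e = 2" using e less.prems by (auto simp: graph_on_def)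
    then obtain a b where "e = {a, b}" "a \<noteq> b" by (auto simp: card_2_iff)
    \<comment> \<open>The edge is oriented so that its free end is \<open>k\<close>; the other end
      may be free or pinned.\<close>
    then obtain j where j: "e = {k, j}" "j \<noteq> k"
      using e(2) by (cases "k = a") (auto simp: insert_commute)
    have fE: "finite E" using less.prems by (rule graph_on_finite)
    have d: "card (E - {e}) < card E" using fE e by (intro card_Diff1_less)
    moreover have "card (contract k j E) \<le> card (E - {e})"
      unfolding contract_def j using fE by (intro card_image_le) simp
    ultimately have c: "card (contract k j E) < card E" by simp
    show ?thesis
      using less.prems e j d c
      by (intro assms(3)[of V E k j] less.hyps graph_on_contract graph_on_subset[of V R E "E - _"]) auto
  qed
qed

section \<open>Open conditions and tubular coordinates\<close>

lemma continuous_map_pinned: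
  "continuous_map (power_space V) euclidean (\<lambda>x. pinned V q x i)"
  using continuous_map_product_projection[of i V "\<lambda>_. euclidean"] by (cases "i \<in> V") (auto simp: pinned_def)

lemma openin_pinned_neq:
  fixes q :: "'i \<Rightarrow> 'a::metric_space"
  shows "openin (power_space V) {x \<in> extensional V. pinned V q x i \<noteq> pinned V q x j}"
proof -
  let ?X = "power_space V :: ('i \<Rightarrow> 'a) topology"
  have "closedin ?X {x \<in> topspace ?X. pinned V q x i = pinned V q x j}"
    by (rule closedin_continuous_maps_eq[OF Hausdorff_space_euclidean continuous_map_pinned continuous_map_pinned])
  then have "openin ?X (topspace ?X - {x \<in> topspace ?X. pinned V q x i = pinned V q x j})"
    by blast
  also have "topspace ?X - {x \<in> topspace ?X. pinned V q x i = pinned V q x j}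
      = {x \<in> extensional V. pinned V q x i \<noteq> pinned V q x j}"
    by (auto simp: PiE_def)
  finally show ?thesis .
qed

lemma openin_confs:
  fixes q :: "'i \<Rightarrow> 'a::metric_space"
  assumes "graph_on V R E"
  shows "openin (power_space V) (confs V q E)"
proof -
  let ?S = "{z. {fst z, snd z} \<in> E}"
  let ?f = "\<lambda>z. {x \<in> extensional V. pinned V q x (fst z) \<noteq> pinned V q x (snd z)}"
  have "?S \<subseteq> (V \<union> R) \<times> (V \<union> R)"
    using assms by (auto simp: graph_on_def)
  moreover have "finite ((V \<union> R) \<times> (V \<union> R))" using assms by (simp add: graph_on_def)
  ultimately have fin: "finite ?S" by (rule finite_subset)
  have ext: "openin (power_space V :: ('i \<Rightarrow> 'a) topology) (extensional V)"
    by (metis openin_topspace topspace_power_space)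
  \<comment> \<open>The whole space is inserted so that the finite family is nonempty even for a
    graph without edges.\<close>
  have "openin (power_space V) (\<Inter> (insert (extensional V) (?f ` ?S)))"
  proof (rule openin_Inter)
    show "finite (insert (extensional V) (?f ` ?S))" using fin by blast
    show "openin (power_space V) X" if "X \<in> insert (extensional V) (?f ` ?S)" for X
      using that ext openin_pinned_neq[of V q] by blast
  qed blast
  also have "\<Inter> (insert (extensional V) (?f ` ?S)) = confs V q E"
    by (force simp: confs_def)
  finally show ?thesis .
qed

text \<open>The tubular coordinates around the locus \<open>x\<^sub>k = x\<^sub>j\<close>: the vertex k is placed at displacement v
  from the vertex j of a configuration b of the contracted graph.\<close>

definition attach :: "'i set \<Rightarrow> ('i \<Rightarrow> 'a::real_normed_vector) \<Rightarrow> 'i \<Rightarrow> 'i \<Rightarrow> ('i \<Rightarrow> 'a) \<times> 'a \<Rightarrow> 'i \<Rightarrow> 'a" where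
  "attach V q k j = (\<lambda>(b, v). b(k := pinned (V - {k}) q b j + v))"

definition detach :: "'i set \<Rightarrow> ('i \<Rightarrow> 'a::real_normed_vector) \<Rightarrow> 'i \<Rightarrow> 'i \<Rightarrow> ('i \<Rightarrow> 'a) \<Rightarrow> ('i \<Rightarrow> 'a) \<times> 'a" where
  "detach V q k j x = (restrict x (V - {k}), x k - pinned V q x j)"

lemma pinned_attach:
  "k \<in> V \<Longrightarrow> pinned V q (attach V q k j (b, v)) i
    = (if i = k then pinned (V - {k}) q b j + v else pinned (V - {k}) q b i)"
  by (auto simp: pinned_def attach_def)

lemma attach_extensional:
  "k \<in> V \<Longrightarrow> b \<in> extensional (V - {k}) \<Longrightarrow> attach V q k j (b, v) \<in> extensional V"
  by (auto simp: attach_def extensional_def)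

lemma detach_attach:
  "k \<in> V \<Longrightarrow> j \<noteq> k \<Longrightarrow> b \<in> extensional (V - {k}) \<Longrightarrow> detach V q k j (attach V q k j (b, v)) = (b, v)"
  by (auto simp: detach_def attach_def pinned_def extensional_def fun_eq_iff restrict_def)

lemma attach_detach:
  "k \<in> V \<Longrightarrow> j \<noteq> k \<Longrightarrow> x \<in> extensional V \<Longrightarrow> attach V q k j (detach V q k j x) = x"
  by (auto simp: detach_def attach_def pinned_def extensional_def fun_eq_iff restrict_def)

lemma continuous_map_attach:
  assumes "k \<in> V"
  shows "continuous_map (prod_topology (power_space (V - {k})) euclidean) (power_space V) (attach V q k j)"
proof (subst continuous_map_componentwise, intro conjI ballI)
  let ?P = "prod_topology (power_space (V - {k})) euclidean :: (('a \<Rightarrow> 'b) \<times> 'b) topology"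
  show "attach V q k j ` topspace ?P \<subseteq> extensional V"
    using attach_extensional[OF assms] by (auto simp: PiE_def)
  fix i assume "i \<in> V"
  have 1: "continuous_map ?P euclidean (\<lambda>z. pinned (V - {k}) q (fst z) j + snd z)"
    by (intro continuous_map_add continuous_map_snd
        continuous_map_compose[OF continuous_map_fst continuous_map_pinned, unfolded o_def])
  have 2: "continuous_map ?P euclidean (\<lambda>z. fst z i)" if "i \<noteq> k"
    using that \<open>i \<in> V\<close>
    by (intro continuous_map_compose[OF continuous_map_fst continuous_map_product_projection, unfolded o_def]) auto
  show "continuous_map ?P euclidean (\<lambda>z. attach V q k j z i)"
    using 1 2 by (cases "i = k") (auto simp: attach_def case_prod_beta')
qed

lemma continuous_map_detach:
  assumes "k \<in> V"
  shows "continuous_map (power_space V) (prod_topology (power_space (V - {k})) euclidean) (detach V q k j)"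
proof -
  have "continuous_map (power_space V :: ('a \<Rightarrow> 'b) topology) (power_space (V - {k})) (\<lambda>x. restrict x (V - {k}))"
    by (intro continuous_map_componentwise[THEN iffD2]) (auto intro!: continuous_map_product_projection)
  moreover have "continuous_map (power_space V) euclidean (\<lambda>x. x k - pinned V q x j)"
    using assms by (intro continuous_map_diff continuous_map_pinned continuous_map_product_projection)
  ultimately show ?thesis
    by (simp add: continuous_map_pairwise o_def detach_def)
qed

lemma confs_remove_edge:
  assumes "{k, j} \<in> E"
  shows "confs V q E = {x \<in> confs V q (E - {{k, j}}). pinned V q x k \<noteq> pinned V q x j}"
  using assms unfolding confs_def by (auto simp: doubleton_eq_iff) metis

text \<open>In tubular coordinates the edge between \<open>k\<close> and \<open>j\<close> says that
  the displacement is nonzero; restoring it removes the zero section.\<close>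

lemma attach_confs_iff:
  assumes "k \<in> V" "j \<noteq> k" "{k, j} \<in> E"
  shows "attach V q k j (b, v) \<in> confs V q E \<longleftrightarrow> attach V q k j (b, v) \<in> confs V q (E - {{k, j}}) \<and> v \<noteq> 0"
  using assms by (subst confs_remove_edge[OF assms(3)]) (auto simp: pinned_attach)

lemma contract_edge_iff:
  assumes "graph_on V R E" "k \<noteq> j"
  shows "{a, b} \<in> contract k j E \<longleftrightarrow> (\<exists>i i'. {i, i'} \<in> E - {{k, j}} \<and> a = merge_vertex k j i \<and> b = merge_vertex k j i')"
proof
  assume "{a, b} \<in> contract k j E"
  then obtain e where e: "e \<in> E - {{k, j}}" "merge_vertex k j ` e = {a, b}" by (auto simp: contract_def)
  then have c: "card e = 2" using assms unfolding graph_on_def by blast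
  obtain x y where xy: "e = {x, y}" using c unfolding card_2_iff by blast
  then have "{merge_vertex k j x, merge_vertex k j y} = {a, b}" using e(2) by simp
  then have "a = merge_vertex k j x \<and> b = merge_vertex k j y \<or> a = merge_vertex k j y \<and> b = merge_vertex k j x"
    by (auto simp: doubleton_eq_iff)
  moreover have "{x, y} \<in> E - {{k, j}}" "{y, x} \<in> E - {{k, j}}" using e(1) xy by (simp_all add: insert_commute)
  ultimately show "\<exists>i i'. {i, i'} \<in> E - {{k, j}} \<and> a = merge_vertex k j i \<and> b = merge_vertex k j i'" by metis
next
  assume "\<exists>i i'. {i, i'} \<in> E - {{k, j}} \<and> a = merge_vertex k j i \<and> b = merge_vertex k j i'"
  then obtain i i' where "{i, i'} \<in> E - {{k, j}}" "a = merge_vertex k j i" "b = merge_vertex k j i'" by blast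
  then show "{a, b} \<in> contract k j E"
    unfolding contract_def by (intro image_eqI[of _ _ "{i, i'}"]) simp_all
qed

text \<open>At displacement 0 the position of each vertex is read off after
  \<open>merge_vertex\<close>, so the conditions of the deleted graph become those of the contracted
  one.\<close>

lemma attach_zero_confs_iff:
  assumes "graph_on V R E" "k \<in> V" "j \<noteq> k" "b \<in> extensional (V - {k})"
  shows "attach V q k j (b, 0) \<in> confs V q (E - {{k, j}}) \<longleftrightarrow> b \<in> confs (V - {k}) q (contract k j E)"
proof -
  let ?p = "pinned (V - {k}) q b"
  have pin: "pinned V q (attach V q k j (b, 0)) i = ?p (merge_vertex k j i)" for i
    unfolding pinned_attach[OF assms(2)] merge_vertex_def by simp
  have "attach V q k j (b, 0) \<in> confs V q (E - {{k, j}})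
      \<longleftrightarrow> (\<forall>i i'. {i, i'} \<in> E - {{k, j}} \<longrightarrow> ?p (merge_vertex k j i) \<noteq> ?p (merge_vertex k j i'))"
    using attach_extensional[OF assms(2,4), of q j 0] unfolding confs_def pin mem_Collect_eq by blast
  also have "\<dots> \<longleftrightarrow> (\<forall>a c. {a, c} \<in> contract k j E \<longrightarrow> ?p a \<noteq> ?p c)"
    unfolding contract_edge_iff[OF assms(1) assms(3)[symmetric]] by metis
  also have "\<dots> \<longleftrightarrow> b \<in> confs (V - {k}) q (contract k j E)"
    using assms(4) by (simp add: confs_def)
  finally show ?thesis .
qed

text \<open>Two pairs that agree, up to the homeomorphism \<open>h\<close>, on open sets
  \<open>W\<close> and \<open>U\<close> are compared through that common part; excision removes the
  rest of each.\<close>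

lemma excision_overlap:
  assumes X: "openin X U" "openin X A" "topspace X \<subseteq> U \<union> A"
    and Y: "openin Y W" "openin Y T" "topspace Y \<subseteq> W \<union> T"
    and h: "homeomorphic_map (subtopology Y W) (subtopology X U) h" "h ` (T \<inter> W) = A \<inter> U"
  shows "hom_induced p (subtopology Y W) (T \<inter> W) X A h
      \<in> iso (relative_homology_group p (subtopology Y W) (T \<inter> W)) (relative_homology_group p X A)"
    and "hom_induced p (subtopology Y W) (T \<inter> W) Y T id
      \<in> iso (relative_homology_group p (subtopology Y W) (T \<inter> W)) (relative_homology_group p Y T)"
proof -
  have "hom_induced p (subtopology Y W) (T \<inter> W) (subtopology X U) (A \<inter> U) h
      \<in> iso (relative_homology_group p (subtopology Y W) (T \<inter> W)) (relative_homology_group p (subtopology X U) (A \<inter> U))"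
    using openin_subset[OF Y(1)] by (intro homeomorphic_map_relative_homology_iso h) auto
  from iso_set_trans[OF this excision_open[OF X]]
  have "hom_induced p (subtopology X U) (A \<inter> U) X A id \<circ> hom_induced p (subtopology Y W) (T \<inter> W) (subtopology X U) (A \<inter> U) h
      \<in> iso (relative_homology_group p (subtopology Y W) (T \<inter> W)) (relative_homology_group p X A)"
    .
  moreover have "continuous_map (subtopology Y W) (subtopology X U) h"
    using h(1) by (rule homeomorphic_imp_continuous_map)
  moreover have "h \<in> T \<inter> W \<rightarrow> A \<inter> U" using h(2) by blast
  ultimately show "hom_induced p (subtopology Y W) (T \<inter> W) X A h
      \<in> iso (relative_homology_group p (subtopology Y W) (T \<inter> W)) (relative_homology_group p X A)"
    by (subst (asm) hom_induced_compose[symmetric]) (auto simp: continuous_map_from_subtopology)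
  show "hom_induced p (subtopology Y W) (T \<inter> W) Y T id
      \<in> iso (relative_homology_group p (subtopology Y W) (T \<inter> W)) (relative_homology_group p Y T)"
    by (rule excision_open[OF Y])
qed

text \<open>The common open part of both spaces. Its fibre over \<open>b\<close> omits the finitely
  many displacements that put \<open>k\<close> on a neighbour other than \<open>j\<close>. These are
  nonzero, because \<open>b\<close> satisfies the edges of the contracted graph, so the zero section
  is contained in it.\<close>

definition gluing :: "'i set \<Rightarrow> ('i \<Rightarrow> 'a::euclidean_space) \<Rightarrow> 'i \<Rightarrow> 'i \<Rightarrow> 'i set set \<Rightarrow> (('i \<Rightarrow> 'a) \<times> 'a) set" where
  "gluing V q k j E = {(b, v). b \<in> confs (V - {k}) q (contract k j E) \<and> attach V q k j (b, v) \<in> confs V q (E - {{k, j}})}"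

abbreviation (input) conf_bundle :: "'i set \<Rightarrow> ('i \<Rightarrow> 'a::euclidean_space) \<Rightarrow> 'i \<Rightarrow> 'i \<Rightarrow> 'i set set \<Rightarrow> (('i \<Rightarrow> 'a) \<times> 'a) topology" where
  "conf_bundle V q k j E \<equiv> prod_topology (conf_space (V - {k}) q (contract k j E)) euclidean"

abbreviation (input) punctured :: "'i set \<Rightarrow> ('i \<Rightarrow> 'a::euclidean_space) \<Rightarrow> 'i \<Rightarrow> 'i \<Rightarrow> 'i set set \<Rightarrow> (('i \<Rightarrow> 'a) \<times> 'a) set" where
  "punctured V q k j E \<equiv> confs (V - {k}) q (contract k j E) \<times> - {0}"

lemma conf_bundle_subtopology:
  "conf_bundle V q k j E
    = subtopology (prod_topology (power_space (V - {k})) euclidean) (confs (V - {k}) q (contract k j E) \<times> UNIV)"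
  by (simp add: conf_space_def prod_topology_subtopology(1))

context
  fixes V R :: "'i set" and q :: "'i \<Rightarrow> 'a::euclidean_space" and k j :: 'i and E :: "'i set set"
  assumes E: "graph_on V R E" and k: "k \<in> V" and j: "j \<noteq> k" and e: "{k, j} \<in> E"
begin

lemma openin_gluing: "openin (conf_bundle V q k j E) (gluing V q k j E)"
proof -
  have "continuous_map (conf_bundle V q k j E) (power_space V) (attach V q k j)"
    unfolding conf_bundle_subtopology
    by (intro continuous_map_from_subtopology continuous_map_attach k)
  moreover have "openin (power_space V) (confs V q (E - {{k, j}}))"
    using E by (intro openin_confs[of V R] graph_on_subset[OF E]) auto
  ultimately have "openin (conf_bundle V q k j E)
      {z \<in> topspace (conf_bundle V q k j E). attach V q k j z \<in> confs V q (E - {{k, j}})}"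
    by (rule openin_continuous_map_preimage)
  moreover have "{z \<in> topspace (conf_bundle V q k j E). attach V q k j z \<in> confs V q (E - {{k, j}})} = gluing V q k j E"
    by (auto simp: gluing_def)
  ultimately show ?thesis by simp
qed

lemma pair_homology_iso:
  shows "hom_induced p (subtopology (conf_bundle V q k j E) (gluing V q k j E)) (punctured V q k j E \<inter> gluing V q k j E)
        (conf_space V q (E - {{k, j}})) (confs V q E) (attach V q k j)
      \<in> iso (relative_homology_group p (subtopology (conf_bundle V q k j E) (gluing V q k j E)) (punctured V q k j E \<inter> gluing V q k j E))
          (relative_homology_group p (conf_space V q (E - {{k, j}})) (confs V q E))"
    and "hom_induced p (subtopology (conf_bundle V q k j E) (gluing V q k j E)) (punctured V q k j E \<inter> gluing V q k j E)
        (conf_bundle V q k j E) (punctured V q k j E) id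
      \<in> iso (relative_homology_group p (subtopology (conf_bundle V q k j E) (gluing V q k j E)) (punctured V q k j E \<inter> gluing V q k j E))
          (relative_homology_group p (conf_bundle V q k j E) (punctured V q k j E))"
proof -
  let ?X = "conf_space V q (E - {{k, j}})" and ?A = "confs V q E" and ?B = "confs (V - {k}) q (contract k j E)"
  let ?Y = "conf_bundle V q k j E" and ?T = "punctured V q k j E" and ?W = "gluing V q k j E"
  \<comment> \<open>\<open>U\<close> is the image of \<open>gluing\<close> under
    \<open>attach\<close>, described without the map so that its openness is visible.\<close>
  define U where "U = {x \<in> confs V q (E - {{k, j}}). restrict x (V - {k}) \<in> ?B}"
  have gc: "graph_on (V - {k}) R (contract k j E)"
    by (rule graph_on_contract[OF E k j e])
  have cd: "continuous_map ?X (prod_topology (power_space (V - {k})) euclidean) (detach V q k j)"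
    unfolding conf_space_def by (intro continuous_map_from_subtopology continuous_map_detach k)
  have X1: "openin ?X U"
  proof -
    have "continuous_map ?X (power_space (V - {k})) (\<lambda>x. restrict x (V - {k}))"
      using continuous_map_compose[OF cd continuous_map_fst] by (simp add: o_def detach_def)
    from openin_continuous_map_preimage[OF this openin_confs[OF gc, of q]]
    show ?thesis by (simp add: U_def)
  qed
  have X2: "openin ?X ?A"
    using openin_subtopology_Int[OF openin_confs[OF E, of q], of "confs V q (E - {{k, j}})"]
      confs_mono[of "E - {{k, j}}" E V q]
    by (simp add: conf_space_def Int_absorb2)
  \<comment> \<open>A configuration outside \<open>?A\<close> has \<open>k\<close> at the position
    of \<open>j\<close>. It is thus attached with displacement 0, and its restriction is a
    configuration of the contracted graph.\<close>
  have X3: "topspace ?X \<subseteq> U \<union> ?A"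
  proof
    fix x assume "x \<in> topspace ?X"
    then have x: "x \<in> confs V q (E - {{k, j}})" by simp
    show "x \<in> U \<union> ?A"
    proof (cases "pinned V q x k = pinned V q x j")
      case True
      then have d: "detach V q k j x = (restrict x (V - {k}), 0)" using k by (simp add: detach_def pinned_def)
      have "x \<in> extensional V" using x by (simp add: confs_def)
      then have "attach V q k j (restrict x (V - {k}), 0) = x"
        using attach_detach[OF k j, of x q] by (simp add: d)
      then have "restrict x (V - {k}) \<in> ?B"
        using attach_zero_confs_iff[OF E k j, of "restrict x (V - {k})" q] x by simp
      then show ?thesis using x by (simp add: U_def)
    qed (use x confs_remove_edge[OF e, of V q] in auto)
  qed
  have Y2: "openin ?Y ?T"
    using openin_topspace[of "conf_space (V - {k}) q (contract k j E)"]
    by (simp add: openin_prod_Times_iff open_Compl)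
  \<comment> \<open>A point outside \<open>?T\<close> lies on the zero section, which is contained
    in \<open>?W\<close>.\<close>
  have Y3: "topspace ?Y \<subseteq> ?W \<union> ?T"
  proof
    fix z assume "z \<in> topspace ?Y"
    then obtain b v where z: "z = (b, v)" "b \<in> ?B" by auto
    then have "attach V q k j (b, 0) \<in> confs V q (E - {{k, j}})"
      using attach_zero_confs_iff[OF E k j, of b q] by (auto simp: confs_def)
    with z show "z \<in> ?W \<union> ?T" by (cases "v = 0") (auto simp: gluing_def)
  qed
  have WB: "?W \<subseteq> ?B \<times> UNIV" by (auto simp: gluing_def)
  have WU: "attach V q k j z \<in> U" if "z \<in> ?W" for z
  proof -
    obtain b v where z: "z = (b, v)" by (cases z)
    then have "b \<in> extensional (V - {k})" using that by (auto simp: gluing_def confs_def)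
    then have "restrict (attach V q k j z) (V - {k}) = b"
      using detach_attach[OF k j, of b q v] z by (simp add: detach_def)
    with that z show ?thesis by (auto simp: gluing_def U_def)
  qed
  have UW: "detach V q k j x \<in> ?W" if "x \<in> U" for x
  proof -
    have "attach V q k j (detach V q k j x) = x"
      using that by (intro attach_detach k j) (auto simp: U_def confs_def)
    with that show ?thesis by (auto simp: gluing_def U_def detach_def)
  qed
  have sX: "subtopology ?X U = subtopology (power_space V) U"
    by (simp add: conf_space_def subtopology_subtopology Int_absorb1 U_def)
  have sY: "subtopology ?Y ?W = subtopology (prod_topology (power_space (V - {k})) euclidean) ?W"
    using WB by (simp add: conf_bundle_subtopology subtopology_subtopology Int_absorb1)
  have "homeomorphic_maps (subtopology ?Y ?W) (subtopology ?X U) (attach V q k j) (detach V q k j)"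
    unfolding homeomorphic_maps_def
  proof (intro conjI ballI)
    show "continuous_map (subtopology ?Y ?W) (subtopology ?X U) (attach V q k j)"
      unfolding sX sY using WU
      by (intro continuous_map_into_subtopology continuous_map_from_subtopology continuous_map_attach k) auto
    show "continuous_map (subtopology ?X U) (subtopology ?Y ?W) (detach V q k j)"
      unfolding sX sY using UW
      by (intro continuous_map_into_subtopology continuous_map_from_subtopology continuous_map_detach k) auto
  next
    fix z assume "z \<in> topspace (subtopology ?Y ?W)"
    then show "detach V q k j (attach V q k j z) = z"
      by (cases z) (auto intro!: detach_attach k j simp: confs_def)
  next
    fix x assume "x \<in> topspace (subtopology ?X U)"
    then show "attach V q k j (detach V q k j x) = x"
      by (auto intro!: attach_detach k j simp: confs_def)
  qed
  then have h1: "homeomorphic_map (subtopology ?Y ?W) (subtopology ?X U) (attach V q k j)"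
    by (rule homeomorphic_maps_imp_map)
  have iff: "attach V q k j z \<in> ?A \<longleftrightarrow> attach V q k j z \<in> confs V q (E - {{k, j}}) \<and> snd z \<noteq> 0" for z
    using attach_confs_iff[OF k j e, of q "fst z" "snd z"] by simp
  have h2: "attach V q k j ` (?T \<inter> ?W) = ?A \<inter> U"
  proof (intro equalityI subsetI)
    fix x assume "x \<in> attach V q k j ` (?T \<inter> ?W)"
    then obtain z where z: "z \<in> ?T" "z \<in> ?W" "x = attach V q k j z" by blast
    then show "x \<in> ?A \<inter> U" using WU[of z] iff[of z] by (auto simp: gluing_def)
  next
    fix x assume x: "x \<in> ?A \<inter> U"
    then have ad: "attach V q k j (detach V q k j x) = x"
      by (intro attach_detach k j) (auto simp: confs_def)
    have "detach V q k j x \<in> ?W" using UW x by blast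
    moreover have "snd (detach V q k j x) \<noteq> 0" using x iff[of "detach V q k j x"] unfolding ad by blast
    ultimately have "detach V q k j x \<in> ?T \<inter> ?W" by (auto simp: gluing_def)
    with ad[symmetric] show "x \<in> attach V q k j ` (?T \<inter> ?W)" by (rule image_eqI)
  qed
  note * = excision_overlap[OF X1 X2 X3 openin_gluing Y2 Y3 h1 h2, of p]
  show "hom_induced p (subtopology ?Y ?W) (?T \<inter> ?W) ?X ?A (attach V q k j)
      \<in> iso (relative_homology_group p (subtopology ?Y ?W) (?T \<inter> ?W)) (relative_homology_group p ?X ?A)"
    by (rule *(1))
  show "hom_induced p (subtopology ?Y ?W) (?T \<inter> ?W) ?Y ?T id
      \<in> iso (relative_homology_group p (subtopology ?Y ?W) (?T \<inter> ?W)) (relative_homology_group p ?Y ?T)"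
    by (rule *(2))
qed

lemma pair_thom_iso:
  "relative_homology_group (p + int DIM('a)) (conf_space V q (E - {{k, j}})) (confs V q E)
    \<cong> homology_group p (conf_space (V - {k}) q (contract k j E))"
proof -
  have "relative_homology_group (p + int DIM('a)) (conf_bundle V q k j E) (punctured V q k j E)
      \<cong> homology_group p (conf_space (V - {k}) q (contract k j E))"
    using thom_iso[of p "conf_space (V - {k}) q (contract k j E)"] by simp
  then show ?thesis
    using pair_homology_iso[of "p + int DIM('a)"]
    by (meson group.iso_sym group_relative_homology_group is_isoI iso_trans)
qed

end

text \<open>The same edge is removed from both graphs and \<open>attach\<close> is given by the same
  formula for both, so both excision isomorphisms commute with the inclusions. The surjectivity
  known for the bundles then passes through the overlaps to the pairs.\<close>

lemma pair_thom_surj: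
  fixes q :: "'i \<Rightarrow> 'a::euclidean_space"
  assumes E': "graph_on V R E'" and k: "k \<in> V" and j: "j \<noteq> k" and e: "{k, j} \<in> E" and sub: "E \<subseteq> E'"
    and surj: "hom_induced p (conf_space (V - {k}) q (contract k j E')) {} (conf_space (V - {k}) q (contract k j E)) {} id
      ` carrier (homology_group p (conf_space (V - {k}) q (contract k j E')))
      = carrier (homology_group p (conf_space (V - {k}) q (contract k j E)))"
  shows "hom_induced (p + int DIM('a)) (conf_space V q (E' - {{k, j}})) (confs V q E') (conf_space V q (E - {{k, j}})) (confs V q E) id
      ` carrier (relative_homology_group (p + int DIM('a)) (conf_space V q (E' - {{k, j}})) (confs V q E'))
      = carrier (relative_homology_group (p + int DIM('a)) (conf_space V q (E - {{k, j}})) (confs V q E))"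
proof -
  let ?n = "p + int DIM('a)"
  let ?X = "\<lambda>E. conf_space V q (E - {{k, j}})" and ?A = "\<lambda>E. confs V q E"
  let ?Y = "\<lambda>E. conf_bundle V q k j E" and ?T = "\<lambda>E. punctured V q k j E" and ?W = "\<lambda>E. gluing V q k j E"
  let ?Z = "\<lambda>E. subtopology (?Y E) (?W E)"
  have E: "graph_on V R E" by (rule graph_on_subset[OF E' sub])
  have e': "{k, j} \<in> E'" using e sub by blast
  have cs: "confs (V - {k}) q (contract k j E') \<subseteq> confs (V - {k}) q (contract k j E)"
    by (intro confs_mono contract_mono sub)
  have ds: "confs V q (E' - {{k, j}}) \<subseteq> confs V q (E - {{k, j}})" using sub by (intro confs_mono) auto
  have As: "?A E' \<subseteq> ?A E" by (intro confs_mono sub)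
  have Ws: "?W E' \<subseteq> ?W E" using cs ds by (auto simp: gluing_def)
  have cX: "continuous_map (?X E') (?X E) id" by (rule continuous_map_conf_space_id[OF ds])
  have cY: "continuous_map (?Y E') (?Y E) id"
  proof -
    have "continuous_map (?Y E') (?Y E) (map_prod id id)"
      unfolding map_prod_def continuous_map_prod_top using continuous_map_conf_space_id[OF cs] continuous_map_id by blast
    then show ?thesis by (simp add: prod.map_id0)
  qed
  have cZ: "continuous_map (?Z E') (?Z E) id"
    using cY Ws by (intro continuous_map_into_subtopology continuous_map_from_subtopology) auto
  have cZY: "continuous_map (?Z F) (?Y F) id" for F
    by (intro continuous_map_from_subtopology) auto
  have cZX: "continuous_map (?Z F) (?X F) (attach V q k j)" if F: "graph_on V R F" for F
  proof -
    have "continuous_map (?Z F) (power_space V) (attach V q k j)"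
      unfolding conf_bundle_subtopology by (intro continuous_map_from_subtopology continuous_map_attach k)
    then show ?thesis unfolding conf_space_def[of V] by (intro continuous_map_into_subtopology) (auto simp: gluing_def)
  qed
  have at: "attach V q k j \<in> ?T F \<inter> ?W F \<rightarrow> ?A F" if "{k, j} \<in> F" for F
    using attach_confs_iff[OF k j that] by (auto simp: gluing_def)
  have 1: "hom_induced ?n (?Y E') (?T E') (?Y E) (?T E) id (hom_induced ?n (?Z E') (?T E' \<inter> ?W E') (?Y E') (?T E') id x)
     = hom_induced ?n (?Z E) (?T E \<inter> ?W E) (?Y E) (?T E) id (hom_induced ?n (?Z E') (?T E' \<inter> ?W E') (?Z E) (?T E \<inter> ?W E) id x)" for x
    using cs Ws by (subst (1 2) hom_induced_compose') (use cY cZ cZY in auto)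
  have 2: "hom_induced ?n (?X E') (?A E') (?X E) (?A E) id (hom_induced ?n (?Z E') (?T E' \<inter> ?W E') (?X E') (?A E') (attach V q k j) x)
     = hom_induced ?n (?Z E) (?T E \<inter> ?W E) (?X E) (?A E) (attach V q k j) (hom_induced ?n (?Z E') (?T E' \<inter> ?W E') (?Z E) (?T E \<inter> ?W E) id x)" for x
    using cs Ws As by (subst (1 2) hom_induced_compose') (use cX cZ cZX[OF E] cZX[OF E'] at[OF e] at[OF e'] in auto)
  let ?GX = "\<lambda>F. relative_homology_group ?n (?X F) (?A F)" and ?GY = "\<lambda>F. relative_homology_group ?n (?Y F) (?T F)"
    and ?GZ = "\<lambda>F. relative_homology_group ?n (?Z F) (?T F \<inter> ?W F)"
  let ?g = "hom_induced ?n (?Z E') (?T E' \<inter> ?W E') (?Z E) (?T E \<inter> ?W E) id"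
    and ?hX = "hom_induced ?n (?X E') (?A E') (?X E) (?A E) id" and ?hY = "hom_induced ?n (?Y E') (?T E') (?Y E) (?T E) id"
  have "?hY ` carrier (?GY E') = carrier (?GY E)"
    using thom_surj[OF continuous_map_conf_space_id[OF cs] surj] unfolding prod.map_id0 topspace_conf_space .
  moreover have "?g ` carrier (?GZ E') = carrier (?GZ E) \<longleftrightarrow> ?hY ` carrier (?GY E') = carrier (?GY E)"
    by (rule iso_square_surj[OF pair_homology_iso(2)[OF E' k j e'] pair_homology_iso(2)[OF E k j e] hom_induced_hom]) (rule 1)
  moreover have "?g ` carrier (?GZ E') = carrier (?GZ E) \<longleftrightarrow> ?hX ` carrier (?GX E') = carrier (?GX E)"
    by (rule iso_square_surj[OF pair_homology_iso(1)[OF E' k j e'] pair_homology_iso(1)[OF E k j e] hom_induced_hom]) (rule 2)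
  ultimately show ?thesis by blast
qed

section \<open>Deletion and contraction\<close>

text \<open>A four lemma in which surjectivity from \<open>S\<close> onto the homology of all of
  \<open>Y\<close> replaces injectivity on the relative groups. It lets the image of
  \<open>y\<close> in \<open>Y\<close> be matched by a class \<open>w\<close> of \<open>S\<close> at
  once.\<close>

lemma surj_homology_subspace_ladder:
  assumes f: "continuous_map X Y f" "f \<in> S \<rightarrow> T"
    and rel: "hom_induced (p + 1) X S Y T f ` carrier (relative_homology_group (p + 1) X S)
      = carrier (relative_homology_group (p + 1) Y T)"
    and surj: "hom_induced p (subtopology X S) {} Y {} f ` carrier (homology_group p (subtopology X S))
      = carrier (homology_group p Y)"
  shows "hom_induced p (subtopology X S) {} (subtopology Y T) {} f ` carrier (homology_group p (subtopology X S))
      = carrier (homology_group p (subtopology Y T))"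
proof
  let ?HS = "homology_group p (subtopology X S)" and ?HT = "homology_group p (subtopology Y T)"
  let ?f = "hom_induced p (subtopology X S) {} (subtopology Y T) {} f"
  let ?i = "hom_induced p (subtopology Y T) {} Y {} id"
  interpret f: group_hom ?HS ?HT ?f
    by (simp add: group_hom.intro group_hom_axioms.intro hom_induced_hom)
  interpret i: group_hom ?HT "homology_group p Y" ?i
    by (simp add: group_hom.intro group_hom_axioms.intro hom_induced_hom)
  have cf: "continuous_map (subtopology X S) (subtopology Y T) f"
    using f by (auto simp: continuous_map_in_subtopology continuous_map_from_subtopology)
  show "?f ` carrier ?HS \<subseteq> carrier ?HT" by (simp add: hom_induced_carrier image_subset_iff)
  show "carrier ?HT \<subseteq> ?f ` carrier ?HS"
  proof
    fix y assume y: "y \<in> carrier ?HT"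
    have "?i y \<in> hom_induced p (subtopology X S) {} Y {} f ` carrier ?HS"
      unfolding surj by (rule hom_induced_carrier)
    then obtain w where w: "w \<in> carrier ?HS" "?i y = hom_induced p (subtopology X S) {} Y {} f w" by blast
    have iw: "?i (?f w) = hom_induced p (subtopology X S) {} Y {} f w"
      using cf by (subst hom_induced_compose') (auto simp: continuous_map_from_subtopology)
    \<comment> \<open>The error \<open>?d\<close> dies in \<open>Y\<close>, so it is a boundary of a
      relative class, which lifts to the pair of \<open>X\<close> and \<open>S\<close> by
      \<open>rel\<close>.\<close>
    let ?d = "y \<otimes>\<^bsub>?HT\<^esub> inv\<^bsub>?HT\<^esub> (?f w)"
    have fw: "?f w \<in> carrier ?HT" by (rule hom_induced_carrier)
    have "?i ?d = ?i y \<otimes>\<^bsub>homology_group p Y\<^esub> inv\<^bsub>homology_group p Y\<^esub> ?i (?f w)"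
      using y fw by simp
    also have "\<dots> = \<one>\<^bsub>homology_group p Y\<^esub>"
      unfolding iw w(2)[symmetric] by (intro i.H.r_inv hom_induced_carrier)
    finally have "?d \<in> kernel ?HT (homology_group p Y) ?i"
      using y fw by (simp only: kernel_def mem_Collect_eq f.H.m_closed f.H.inv_closed simp_thms)
    moreover have "kernel ?HT (homology_group p Y) ?i = hom_boundary (p + 1) Y T ` carrier (relative_homology_group (p + 1) Y T)"
      using homology_exactness_axiom_2[of "p + 1" Y T] by simp
    ultimately have "?d \<in> hom_boundary (p + 1) Y T ` hom_induced (p + 1) X S Y T f ` carrier (relative_homology_group (p + 1) X S)"
      unfolding rel by (simp only:)
    then obtain r' where r': "r' \<in> carrier (relative_homology_group (p + 1) X S)"
      "?d = hom_boundary (p + 1) Y T (hom_induced (p + 1) X S Y T f r')"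
      by (elim imageE) (simp only:)
    then have d: "?d = ?f (hom_boundary (p + 1) X S r')"
      using fun_cong[OF naturality_hom_induced[OF f, of "p + 1"], of r'] by simp
    have b: "hom_boundary (p + 1) X S r' \<in> carrier ?HS"
      using hom_boundary_carrier[of "p + 1" X S r'] by simp
    have "y = ?d \<otimes>\<^bsub>?HT\<^esub> ?f w"
      using y w by (simp add: f.H.m_assoc)
    also have "\<dots> = ?f (hom_boundary (p + 1) X S r' \<otimes>\<^bsub>?HS\<^esub> w)"
      using b w d by simp
    finally show "y \<in> ?f ` carrier ?HS" using b w by blast
  qed
qed

text \<open>Surjectivity in degree \<open>p + 1\<close> makes the map from absolute to relative
  homology zero there, and by exactness the boundary out of that relative group is
  injective.\<close>

lemma split_pair_sequence:
  assumes surj: "\<And>p. hom_induced p (subtopology X S) {} X {} id ` carrier (homology_group p (subtopology X S))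
      = carrier (homology_group p X)"
  shows "inj_on (hom_boundary (p + 1) X S) (carrier (relative_homology_group (p + 1) X S))"
    and "hom_boundary (p + 1) X S ` carrier (relative_homology_group (p + 1) X S)
      = kernel (homology_group p (subtopology X S)) (homology_group p X) (hom_induced p (subtopology X S) {} X {} id)"
proof -
  let ?R = "relative_homology_group (p + 1) X S" and ?j = "hom_induced (p + 1) X {} X S id"
  interpret b: group_hom ?R "homology_group p (subtopology X S)" "hom_boundary (p + 1) X S"
    using hom_boundary_hom[of "p + 1" X S] by (simp add: group_hom.intro group_hom_axioms.intro)
  have "kernel (homology_group (p + 1) X) ?R ?j = carrier (homology_group (p + 1) X)"
    using homology_exactness_axiom_3[of "p + 1" X S] surj[of "p + 1"] by simp
  then have "?j ` carrier (homology_group (p + 1) X) \<subseteq> {\<one>\<^bsub>?R\<^esub>}"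
    by (auto simp: kernel_def)
  moreover have "kernel ?R (homology_group p (subtopology X S)) (hom_boundary (p + 1) X S) = ?j ` carrier (homology_group (p + 1) X)"
    using homology_exactness_axiom_1[of "p + 1" X S] by simp
  moreover have "\<one>\<^bsub>?R\<^esub> \<in> kernel ?R (homology_group p (subtopology X S)) (hom_boundary (p + 1) X S)"
    by (simp add: kernel_def)
  ultimately have "kernel ?R (homology_group p (subtopology X S)) (hom_boundary (p + 1) X S) = {\<one>\<^bsub>?R\<^esub>}"
    by blast
  then show "inj_on (hom_boundary (p + 1) X S) (carrier ?R)"
    by (simp add: b.inj_iff_trivial_ker)
  show "hom_boundary (p + 1) X S ` carrier ?R
      = kernel (homology_group p (subtopology X S)) (homology_group p X) (hom_induced p (subtopology X S) {} X {} id)"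
    using homology_exactness_axiom_2[of "p + 1" X S] by simp
qed

text \<open>Restricting to \<open>V\<close> keeps the homotopy among extensional functions; its ends
  are \<open>id\<close> and \<open>f\<close> because all points of \<open>S\<close> are
  extensional.\<close>

lemma homotopic_with_straight_line:
  fixes X :: "('i \<Rightarrow> 'a::real_normed_vector) topology"
  assumes X: "X = subtopology (power_space V) S" "S \<subseteq> extensional V" and f: "continuous_map X X f"
    and line: "\<And>x t. x \<in> S \<Longrightarrow> 0 \<le> t \<Longrightarrow> t \<le> 1 \<Longrightarrow> (\<lambda>i\<in>V. (1 - t) *\<^sub>R x i + t *\<^sub>R f x i) \<in> S"
  shows "homotopic_with (\<lambda>_. True) X X id f"
proof -
  let ?I = "top_of_set {0..1::real}"
  let ?h = "\<lambda>z. \<lambda>i\<in>V. (1 - fst z) *\<^sub>R snd z i + fst z *\<^sub>R f (snd z) i"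
  have top: "topspace X = S" using X by (auto simp: PiE_def)
  have fS: "f x \<in> S" if "x \<in> S" for x using continuous_map_funspace[OF f] that top by auto
  have proj: "continuous_map X euclidean (\<lambda>x. x i)" if "i \<in> V" for i
    unfolding X(1) using continuous_map_product_projection[OF that, of "\<lambda>_. euclidean"]
    by (rule continuous_map_from_subtopology)
  have t: "continuous_map (prod_topology ?I X) euclideanreal fst"
    using continuous_map_fst[of ?I X] continuous_map_into_fulltopology by blast
  have "continuous_map (prod_topology ?I X) euclidean (\<lambda>z. (1 - fst z) *\<^sub>R snd z i + fst z *\<^sub>R f (snd z) i)" if "i \<in> V" for i
    by (intro continuous_map_add continuous_map_scaleR continuous_map_diff t continuous_map_const[THEN iffD2]
        continuous_map_compose[OF continuous_map_snd proj[OF that], unfolded o_def]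
        continuous_map_compose[OF continuous_map_compose[OF continuous_map_snd f] proj[OF that], unfolded o_def]) auto
  then have "continuous_map (prod_topology ?I X) (power_space V) ?h"
    by (subst continuous_map_componentwise) auto
  moreover have "?h z \<in> S" if "z \<in> topspace (prod_topology ?I X)" for z
    using that top by (intro line) auto
  ultimately have c: "continuous_map (prod_topology ?I X) X ?h"
    unfolding X(1) by (intro continuous_map_into_subtopology) (auto simp: X(1))
  have 0: "?h (0, x) = id x" if "x \<in> topspace X" for x
  proof -
    have "x \<in> extensional V" using that X(2) top by auto
    then show ?thesis by (simp add: extensional_restrict)
  qed
  have 1: "?h (1, x) = f x" if "x \<in> topspace X" for x
  proof -
    have "f x \<in> extensional V" using that fS X(2) top by auto
    then show ?thesis by (simp add: extensional_restrict)
  qed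
  show ?thesis
  proof (rule iffD2[OF homotopic_with])
    show "\<exists>h. continuous_map (prod_topology ?I X) X h \<and> (\<forall>x\<in>topspace X. h (0, x) = id x) \<and>
        (\<forall>x\<in>topspace X. h (1, x) = f x) \<and> (\<forall>t\<in>{0..1::real}. True)"
    proof (rule exI[of _ ?h], intro conjI)
      show "continuous_map (prod_topology ?I X) X ?h" by (rule c)
      show "\<forall>x\<in>topspace X. ?h (0, x) = id x" by (rule ballI) (rule 0)
      show "\<forall>x\<in>topspace X. ?h (1, x) = f x" by (rule ballI) (rule 1)
    qed simp
  qed (rule refl)
qed

text \<open>Every edge left compares two pinned points, and these are distinct by injectivity of
  \<open>q\<close>, so no condition on the free vertices remains.\<close>

lemma confs_no_free_edges:
  assumes "graph_on V R E" "inj_on q R" "\<And>e. e \<in> E \<Longrightarrow> e \<inter> V = {}"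
  shows "confs V q E = extensional V"
proof -
  have "pinned V q x i \<noteq> pinned V q x j" if e: "{i, j} \<in> E" for x i j
  proof -
    have "{i, j} \<inter> V = {}" using assms(3)[OF e] .
    moreover have "{i, j} \<subseteq> V \<union> R \<and> card {i, j} = 2"
      using assms(1) e unfolding graph_on_def by (elim conjE) (erule bspec)
    ultimately have "i \<notin> V" "j \<notin> V" "i \<in> R" "j \<in> R" "i \<noteq> j" by (auto split: if_splits)
    then show ?thesis using assms(2) by (auto simp: pinned_def inj_on_def)
  qed
  then show ?thesis by (auto simp: confs_def)
qed

lemma confs_nonempty:
  fixes q :: "'i \<Rightarrow> 'a::euclidean_space"
  assumes E: "graph_on V R E" and q: "inj_on q R"
  obtains c where "c \<in> confs V q E"
proof -
  have fin: "finite V" "finite R" using E by (auto simp: graph_on_def)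
  have "infinite (UNIV :: 'a set)" using finite_imp_bounded not_bounded_UNIV by blast
  then have "infinite (UNIV - q ` R)" using fin by (intro Diff_infinite_finite) auto
  \<comment> \<open>\<open>f\<close> enumerates distinct points away from the pinned ones, and
    \<open>g\<close> numbers the free vertices.\<close>
  then obtain f :: "nat \<Rightarrow> 'a" where f: "inj f" "range f \<subseteq> UNIV - q ` R"
    by (meson infinite_countable_subset)
  obtain g :: "'i \<Rightarrow> nat" where g: "inj_on g V"
    using finite_imp_inj_to_nat_seg[OF fin(1)] by blast
  define c where "c = restrict (f \<circ> g) V"
  have "pinned V q c i \<noteq> pinned V q c j" if e: "{i, j} \<in> E" for i j
  proof -
    have "{i, j} \<subseteq> V \<union> R \<and> card {i, j} = 2"
      using E e unfolding graph_on_def by (elim conjE) (erule bspec)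
    then have ij: "i \<in> V \<union> R" "j \<in> V \<union> R" "i \<noteq> j" by auto
    have n: "f a \<noteq> q b" "q b \<noteq> f a" if "b \<in> R" for a b using f(2) that by (metis DiffE image_eqI rangeI subsetD)+
    have fg: "f (g i) = f (g j) \<longrightarrow> i \<in> V \<longrightarrow> j \<in> V \<longrightarrow> False"
      using f(1) g ij(3) by (meson inj_onD UNIV_I)
    show ?thesis
      using ij n fg q by (auto simp: pinned_def c_def inj_on_def)
  qed
  then have "c \<in> confs V q E" by (simp add: confs_def c_def)
  then show ?thesis by (rule that)
qed

lemma homotopic_with_const_no_free_edges:
  fixes q :: "'i \<Rightarrow> 'a::euclidean_space"
  assumes "confs V q E = extensional V" "c \<in> extensional V"
  shows "homotopic_with (\<lambda>_. True) (conf_space V q E) (conf_space V q E) id (\<lambda>_. c)"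
proof (rule homotopic_with_straight_line)
  show "conf_space V q E = subtopology (power_space V) (extensional V)"
    by (simp add: conf_space_def assms(1))
qed (use assms in auto)

text \<open>The induction is on the smaller graph, with the larger graph and the degree left
  arbitrary: the contraction step changes both.\<close>

theorem conf_space_homology_surj:
  fixes q :: "'i \<Rightarrow> 'a::euclidean_space"
  assumes "graph_on V R E" "graph_on V R E'" "E \<subseteq> E'" and q: "inj_on q R"
  shows "hom_induced p (conf_space V q E') {} (conf_space V q E) {} id ` carrier (homology_group p (conf_space V q E'))
      = carrier (homology_group p (conf_space V q E))"
  using assms(1-3)
proof (induction arbitrary: E' p rule: graph_deletion_contraction_induct)
  case (base V E)
  let ?X' = "conf_space V q E'" and ?X = "conf_space V q E"
  \<comment> \<open>The larger space contracts to any of its points. Choosing \<open>c\<close> in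
    the smaller space lets the contraction factor through it.\<close>
  obtain c where c: "c \<in> confs V q E'" using confs_nonempty[OF base(3) q] .
  have ext: "confs V q E = extensional V" by (rule confs_no_free_edges[OF base(1) q base(2)])
  have inc: "continuous_map ?X' ?X id"
    using base(4) by (intro continuous_map_conf_space_id confs_mono)
  have cc: "continuous_map ?X ?X' (\<lambda>_. c)" using c by simp
  have "y \<in> hom_induced p ?X' {} ?X {} id ` carrier (homology_group p ?X')" if y: "y \<in> carrier (homology_group p ?X)" for y
  proof -
    have "y = hom_induced p ?X {} ?X {} (\<lambda>_. c) y"
    proof -
      have "c \<in> extensional V" using c confs_extensional by blast
      from homology_homotopy_empty[OF homotopic_with_const_no_free_edges[OF ext this], of p]
      show ?thesis using hom_induced_id[OF y] by (simp only:)
    qed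
    also have "\<dots> = hom_induced p ?X' {} ?X {} id (hom_induced p ?X {} ?X' {} (\<lambda>_. c) y)"
      using inc cc by (subst hom_induced_compose') (auto simp: o_def)
    finally show ?thesis by (metis hom_induced_carrier image_eqI)
  qed
  then show ?case by (intro equalityI image_subsetI subsetI hom_induced_carrier)
next
  case (step V E k j)
  let ?e = "{k, j}"
  have E': "graph_on V R (E' - {?e})" "graph_on V R (E - {?e})"
    by (rule graph_on_subset[OF step.prems(1) Diff_subset], rule graph_on_subset[OF step.hyps(1) Diff_subset])
  have e': "?e \<in> E'" by (rule subsetD[OF step.prems(2) step.hyps(4)])
  have ss: "confs V q E' \<subseteq> confs V q (E' - {?e})" "confs V q E \<subseteq> confs V q (E - {?e})"
    by (intro confs_mono Diff_subset)+
  have sub: "subtopology (conf_space V q (E' - {?e})) (confs V q E') = conf_space V q E'"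
    "subtopology (conf_space V q (E - {?e})) (confs V q E) = conf_space V q E"
    by (intro conf_space_subtopology ss)+
  have "hom_induced p (subtopology (conf_space V q (E' - {?e})) (confs V q E')) {} (subtopology (conf_space V q (E - {?e})) (confs V q E)) {} id
      ` carrier (homology_group p (subtopology (conf_space V q (E' - {?e})) (confs V q E')))
      = carrier (homology_group p (subtopology (conf_space V q (E - {?e})) (confs V q E)))"
  proof (rule surj_homology_subspace_ladder)
    show "continuous_map (conf_space V q (E' - {?e})) (conf_space V q (E - {?e})) id"
      by (intro continuous_map_conf_space_id confs_mono Diff_mono step.prems(2) subset_refl)
    show "id \<in> confs V q E' \<rightarrow> confs V q E"
      using confs_mono[OF step.prems(2), of V q] by auto
    \<comment> \<open>Degrees are integers, so this also covers negative degrees without a case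
      distinction.\<close>
    have "hom_induced (p + 1 - int DIM('a)) (conf_space (V - {k}) q (contract k j E')) {} (conf_space (V - {k}) q (contract k j E)) {} id
        ` carrier (homology_group (p + 1 - int DIM('a)) (conf_space (V - {k}) q (contract k j E')))
        = carrier (homology_group (p + 1 - int DIM('a)) (conf_space (V - {k}) q (contract k j E)))"
      by (intro step.IH graph_on_contract contract_mono step e')
    from pair_thom_surj[OF step.prems(1) step.hyps(2,3,4) step.prems(2) this]
    show "hom_induced (p + 1) (conf_space V q (E' - {?e})) (confs V q E') (conf_space V q (E - {?e})) (confs V q E) id
      ` carrier (relative_homology_group (p + 1) (conf_space V q (E' - {?e})) (confs V q E'))
      = carrier (relative_homology_group (p + 1) (conf_space V q (E - {?e})) (confs V q E))"
      by simp
    \<comment> \<open>The induction hypothesis for the deleted graph is compared with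
      \<open>E'\<close> itself, from which no edge has been removed.\<close>
    show "hom_induced p (subtopology (conf_space V q (E' - {?e})) (confs V q E')) {} (conf_space V q (E - {?e})) {} id
      ` carrier (homology_group p (subtopology (conf_space V q (E' - {?e})) (confs V q E')))
      = carrier (homology_group p (conf_space V q (E - {?e})))"
      unfolding sub by (rule step.IH(1)[OF step.prems(1)]) (use step.prems(2) in blast)
  qed
  then show ?case unfolding sub .
qed

section \<open>Short exact sequences of deletion and contraction\<close>

context
  fixes V R :: "'i set" and q :: "'i \<Rightarrow> 'a::euclidean_space" and k j :: 'i and E :: "'i set set"
  assumes E: "graph_on V R E" and q: "inj_on q R" and k: "k \<in> V" and j: "j \<noteq> k" and e: "{k, j} \<in> E"
begin

lemma deletion_contraction_sequence:
  obtains f g where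
    "f \<in> hom (relative_homology_group (p + 1) (conf_space V q (E - {{k, j}})) (confs V q E)) (homology_group p (conf_space V q E))"
    "g \<in> hom (homology_group p (conf_space V q E)) (homology_group p (conf_space V q (E - {{k, j}})))"
    "inj_on f (carrier (relative_homology_group (p + 1) (conf_space V q (E - {{k, j}})) (confs V q E)))"
    "g ` carrier (homology_group p (conf_space V q E)) = carrier (homology_group p (conf_space V q (E - {{k, j}})))"
    "f ` carrier (relative_homology_group (p + 1) (conf_space V q (E - {{k, j}})) (confs V q E))
      = kernel (homology_group p (conf_space V q E)) (homology_group p (conf_space V q (E - {{k, j}}))) g"
proof -
  let ?X = "conf_space V q (E - {{k, j}})" and ?S = "confs V q E"
  have "confs V q E \<subseteq> confs V q (E - {{k, j}})" by (intro confs_mono Diff_subset)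
  then have sub: "subtopology ?X ?S = conf_space V q E" by (rule conf_space_subtopology)
  have surj: "hom_induced p (subtopology ?X ?S) {} ?X {} id ` carrier (homology_group p (subtopology ?X ?S))
      = carrier (homology_group p ?X)" for p
    unfolding sub
    by (rule conf_space_homology_surj[OF graph_on_subset[OF E Diff_subset] E Diff_subset q])
  have b: "hom_boundary (p + 1) ?X ?S \<in> hom (relative_homology_group (p + 1) ?X ?S) (homology_group p (subtopology ?X ?S))"
    using hom_boundary_hom[of "p + 1" ?X ?S] by simp
  show thesis
    by (rule that[OF b[unfolded sub] hom_induced_hom split_pair_sequence(1)[OF surj] surj[unfolded sub]
          split_pair_sequence(2)[OF surj, unfolded sub]])
qed

lemma deletion_contraction_pair:
  "relative_homology_group (p + 1) (conf_space V q (E - {{k, j}})) (confs V q E)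
    \<cong> homology_group (p + 1 - int DIM('a)) (conf_space (V - {k}) q (contract k j E))"
  using pair_thom_iso[OF E k j e, of "p + 1 - int DIM('a)" q] by simp

lemma deletion_contraction_torsion_free:
  assumes "torsion_free (homology_group p (conf_space V q (E - {{k, j}})))"
    and "torsion_free (homology_group (p + 1 - int DIM('a)) (conf_space (V - {k}) q (contract k j E)))"
    and "finite_rank (homology_group (p + 1 - int DIM('a)) (conf_space (V - {k}) q (contract k j E)))"
  shows "torsion_free (homology_group p (conf_space V q E))"
proof -
  note * = grank_iso[OF abelian_relative_homology_group abelian_homology_group deletion_contraction_pair[of p]]
  obtain f g where fg:
    "f \<in> hom (relative_homology_group (p + 1) (conf_space V q (E - {{k, j}})) (confs V q E)) (homology_group p (conf_space V q E))"
    "g \<in> hom (homology_group p (conf_space V q E)) (homology_group p (conf_space V q (E - {{k, j}})))"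
    "inj_on f (carrier (relative_homology_group (p + 1) (conf_space V q (E - {{k, j}})) (confs V q E)))"
    "g ` carrier (homology_group p (conf_space V q E)) = carrier (homology_group p (conf_space V q (E - {{k, j}})))"
    "f ` carrier (relative_homology_group (p + 1) (conf_space V q (E - {{k, j}})) (confs V q E))
      = kernel (homology_group p (conf_space V q E)) (homology_group p (conf_space V q (E - {{k, j}}))) g"
    by (rule deletion_contraction_sequence)
  show ?thesis
    by (rule torsion_free_extension[OF abelian_relative_homology_group abelian_homology_group abelian_homology_group fg
          *(3)[OF assms(3,2)] assms(1)])
qed

lemma deletion_contraction_grank:
  assumes "finite_rank (homology_group p (conf_space V q (E - {{k, j}})))"
    and "finite_rank (homology_group (p + 1 - int DIM('a)) (conf_space (V - {k}) q (contract k j E)))"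
  shows "finite_rank (homology_group p (conf_space V q E))"
    and "grank (homology_group p (conf_space V q E)) = grank (homology_group (p + 1 - int DIM('a)) (conf_space (V - {k}) q (contract k j E)))
      + grank (homology_group p (conf_space V q (E - {{k, j}})))"
proof -
  note * = grank_iso[OF abelian_relative_homology_group abelian_homology_group deletion_contraction_pair[of p] assms(2)]
  obtain f g where fg:
    "f \<in> hom (relative_homology_group (p + 1) (conf_space V q (E - {{k, j}})) (confs V q E)) (homology_group p (conf_space V q E))"
    "g \<in> hom (homology_group p (conf_space V q E)) (homology_group p (conf_space V q (E - {{k, j}})))"
    "inj_on f (carrier (relative_homology_group (p + 1) (conf_space V q (E - {{k, j}})) (confs V q E)))"
    "g ` carrier (homology_group p (conf_space V q E)) = carrier (homology_group p (conf_space V q (E - {{k, j}})))"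
    "f ` carrier (relative_homology_group (p + 1) (conf_space V q (E - {{k, j}})) (confs V q E))
      = kernel (homology_group p (conf_space V q E)) (homology_group p (conf_space V q (E - {{k, j}}))) g"
    by (rule deletion_contraction_sequence)
  note ** = grank_extension[OF abelian_relative_homology_group abelian_homology_group abelian_homology_group fg *(1) assms(1)]
  show "finite_rank (homology_group p (conf_space V q E))" by (rule **(1))
  show "grank (homology_group p (conf_space V q E)) = grank (homology_group (p + 1 - int DIM('a)) (conf_space (V - {k}) q (contract k j E)))
      + grank (homology_group p (conf_space V q (E - {{k, j}})))"
    unfolding **(2) *(2) ..
qed

end

section \<open>Base case, freeness of homology and Poincare series\<close>

lemma homology_contractible:
  assumes h: "homotopic_with (\<lambda>_. True) X X id (\<lambda>_. c)" and c: "c \<in> topspace X"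
  shows "torsion_free (homology_group p X)" "finite_rank (homology_group p X)"
    "grank (homology_group p X) = (if p = 0 then 1 else 0)"
proof -
  let ?P = "discrete_topology {c}"
  have "X homotopy_equivalent_space ?P"
    unfolding homotopy_equivalent_space_def
  proof (intro exI conjI)
    show "continuous_map X ?P (\<lambda>_. c)" by simp
    show "continuous_map ?P X id" using c by (simp add: continuous_map_from_discrete_topology)
    show "homotopic_with (\<lambda>_. True) X X (id \<circ> (\<lambda>_. c)) id"
      using h by (simp add: o_def homotopic_with_sym)
    show "homotopic_with (\<lambda>_. True) ?P ?P ((\<lambda>_. c) \<circ> id) id"
      by (rule homotopic_with_equal) auto
  qed
  then have iso: "homology_group p X \<cong> homology_group p ?P"
    by (rule homotopy_equivalent_space_imp_isomorphic_homology_groups)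
  note ** = grank_iso[OF abelian_homology_group abelian_homology_group iso]
  have top: "topspace ?P = {c}" by simp
  have P: "torsion_free (homology_group p ?P) \<and> finite_rank (homology_group p ?P) \<and>
    grank (homology_group p ?P) = (if p = 0 then 1 else 0)"
  proof (cases "p = 0")
    case True
    show ?thesis
      using grank_iso[OF abelian_homology_group abelian_integer_group homology_coefficients[OF top]] grank_integer_group True
      by simp
  next
    case False
    show ?thesis
      using grank_trivial_group[OF homology_dimension_axiom[OF top False]] False by simp
  qed
  then show "torsion_free (homology_group p X)" "finite_rank (homology_group p X)"
    "grank (homology_group p X) = (if p = 0 then 1 else 0)"
    using ** by simp_all
qed

lemma homology_no_free_edges:
  fixes q :: "'i \<Rightarrow> 'a::euclidean_space"
  assumes "graph_on V R E" "inj_on q R" "\<And>e. e \<in> E \<Longrightarrow> e \<inter> V = {}"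
  shows "torsion_free (homology_group p (conf_space V q E))" "finite_rank (homology_group p (conf_space V q E))"
    "grank (homology_group p (conf_space V q E)) = (if p = 0 then 1 else 0)"
proof -
  have ext: "confs V q E = extensional V" by (rule confs_no_free_edges[OF assms])
  have c: "(\<lambda>_. undefined) \<in> extensional V" by (simp add: extensional_def)
  have c': "(\<lambda>_. undefined) \<in> topspace (conf_space V q E)" using c ext by simp
  note * = homology_contractible[OF homotopic_with_const_no_free_edges[OF ext c] c', of p]
  show "torsion_free (homology_group p (conf_space V q E))" "finite_rank (homology_group p (conf_space V q E))"
    "grank (homology_group p (conf_space V q E)) = (if p = 0 then 1 else 0)"
    by (rule *)+
qed

theorem conf_space_homology_free:
  fixes q :: "'i \<Rightarrow> 'a::euclidean_space"
  assumes "graph_on V R E" and q: "inj_on q R"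
  shows "torsion_free (homology_group p (conf_space V q E)) \<and> finite_rank (homology_group p (conf_space V q E))"
  using assms(1)
proof (induction arbitrary: p rule: graph_deletion_contraction_induct)
  case (base V E)
  then show ?case using homology_no_free_edges[OF base(1) q base(2)] by blast
next
  case (step V E k j)
  show ?case
    using deletion_contraction_torsion_free[OF step.hyps(1) q step.hyps(2,3,4), of p]
      deletion_contraction_grank(1)[OF step.hyps(1) q step.hyps(2,3,4), of p] step.IH by blast
qed

text \<open>The exponent is the dimension, from the Thom isomorphism, minus the one degree lost
  under the boundary map.\<close>

lemma poincare_deletion_contraction:
  fixes q :: "'i \<Rightarrow> 'a::euclidean_space"
  assumes E: "graph_on V R E" and q: "inj_on q R" and kj: "k \<in> V" "j \<noteq> k" "{k, j} \<in> E"
  shows "poincare (conf_space V q E) = poincare (conf_space V q (E - {{k, j}}))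
    + fps_X ^ (DIM('a) - 1) * poincare (conf_space (V - {k}) q (contract k j E))"
proof (rule fps_ext)
  fix i
  let ?C = "conf_space (V - {k}) q (contract k j E)" and ?D = "conf_space V q (E - {{k, j}})"
  have "graph_on V R (E - {{k, j}})" by (rule graph_on_subset[OF E Diff_subset])
  then have g: "grank (homology_group (int i) (conf_space V q E))
      = grank (homology_group (int i + 1 - int DIM('a)) ?C) + grank (homology_group (int i) ?D)"
    using conf_space_homology_free[OF _ q] graph_on_contract[OF E kj]
    by (intro deletion_contraction_grank(2)[OF E q kj]) auto
  have N: "DIM('a) \<ge> 1" by (simp add: Suc_leI)
  \<comment> \<open>Below degree \<open>DIM('a) - 1\<close> the contracted space is evaluated in
    negative degree, where homology vanishes; this matches the coefficients shifted by the power of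
    \<open>fps_X\<close>.\<close>
  have "real (grank (homology_group (int i + 1 - int DIM('a)) ?C)) = fps_nth (fps_X ^ (DIM('a) - 1) * poincare ?C) i"
  proof (cases "i < DIM('a) - 1")
    case True
    then have "trivial_group (homology_group (int i + 1 - int DIM('a)) ?C)" by (intro trivial_homology_group) linarith
    then show ?thesis using True by (simp only: grank_trivial_group(2)) (simp add: fps_X_power_mult_nth)
  next
    case False
    then have "int i + 1 - int DIM('a) = int (i - (DIM('a) - 1))" using N by linarith
    then show ?thesis using False by (simp only:) (simp add: fps_X_power_mult_nth poincare_def)
  qed
  then show "fps_nth (poincare (conf_space V q E)) i = fps_nth (poincare ?D + fps_X ^ (DIM('a) - 1) * poincare ?C) i"
    using g by (simp add: poincare_def)
qed

lemma poincare_no_free_edges: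
  fixes q :: "'i \<Rightarrow> 'a::euclidean_space"
  assumes "graph_on V R E" "inj_on q R" "\<And>e. e \<in> E \<Longrightarrow> e \<inter> V = {}"
  shows "poincare (conf_space V q E) = 1"
  by (rule fps_ext) (simp add: poincare_def homology_no_free_edges(3)[OF assms])

text \<open>Serves to show that the divisor in the final formula is nonzero. The constant term is 1
  in the base case, and the recursion only adds nonnegative terms.\<close>

lemma poincare_nth_0_ge_1:
  fixes q :: "'i \<Rightarrow> 'a::euclidean_space"
  assumes "graph_on V R E" and q: "inj_on q R"
  shows "fps_nth (poincare (conf_space V q E)) 0 \<ge> 1"
  using assms(1)
proof (induction rule: graph_deletion_contraction_induct)
  case (base V E)
  then show ?case using poincare_no_free_edges[OF base(1) q base(2)] by simp
next
  case (step V E k j)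
  have "fps_nth (fps_X ^ (DIM('a) - 1) * poincare (conf_space (V - {k}) q (contract k j E))) 0 \<ge> 0"
    by (simp add: fps_X_power_mult_nth poincare_def)
  then show ?case
    using step.IH(1) by (simp add: poincare_deletion_contraction[OF step.hyps(1) q step.hyps(2,3,4)])
qed

section \<open>Factoring out the obstacles\<close>

lemma confs_full:
  assumes "\<And>e. e \<in> E \<Longrightarrow> e \<subseteq> V"
  shows "confs V q E = {x \<in> extensional V. \<forall>i j. {i, j} \<in> E \<longrightarrow> x i \<noteq> x j}"
proof -
  have "pinned V q x i = x i" "pinned V q x j = x j" if "{i, j} \<in> E" for x i j
    using assms[OF that] by (auto simp: pinned_def)
  then show ?thesis unfolding confs_def by metis
qed

text \<open>Vertices of \<open>W\<close> outside the image of \<open>\<tau>\<close> are isolated and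
  may be contracted away. It serves both to drop isolated vertices, with \<open>\<tau>\<close> the
  identity, and to shift the labels of the obstacles.\<close>

lemma conf_space_homotopy_equivalent_relabel:
  fixes \<tau> :: "'j \<Rightarrow> 'i" and q :: "'i \<Rightarrow> 'a::euclidean_space" and q' :: "'j \<Rightarrow> 'a"
  assumes \<tau>: "inj_on \<tau> U" "\<tau> ` U \<subseteq> W" and F: "graph_on U {} F"
  shows "conf_space W q ((`) \<tau> ` F) homotopy_equivalent_space conf_space U q' F"
proof -
  let ?E = "(`) \<tau> ` F" and ?X = "conf_space W q ((`) \<tau> ` F)" and ?Y = "conf_space U q' F"
  \<comment> \<open>Isolated vertices are placed at 0; coincidences there are harmless because no
    edge meets them.\<close>
  let ?f = "\<lambda>x. \<lambda>a\<in>U. x (\<tau> a)" and ?g = "\<lambda>y. \<lambda>w\<in>W. if w \<in> \<tau> ` U then y (inv_into U \<tau> w) else 0 :: 'a"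
  have FU: "e \<subseteq> U" if "e \<in> F" for e using F that by (auto simp: graph_on_def)
  have X: "confs W q ?E = {x \<in> extensional W. \<forall>i j. {i, j} \<in> ?E \<longrightarrow> x i \<noteq> x j}"
    by (rule confs_full) (use FU \<tau>(2) in blast)
  have Y: "confs U q' F = {x \<in> extensional U. \<forall>i j. {i, j} \<in> F \<longrightarrow> x i \<noteq> x j}"
    by (rule confs_full) (rule FU)
  have edge: "\<exists>a b. a \<in> U \<and> b \<in> U \<and> {a, b} \<in> F \<and> i = \<tau> a \<and> j = \<tau> b" if ij: "{i, j} \<in> ?E" for i j
  proof -
    obtain e where e: "e \<in> F" "{i, j} = \<tau> ` e" using ij by blast
    then have "card e = 2" using F unfolding graph_on_def by blast
    then obtain a b where ab: "e = {a, b}" unfolding card_2_iff by blast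
    have U: "a \<in> U" "b \<in> U" using FU[OF e(1)] ab by auto
    have "{i, j} = {\<tau> a, \<tau> b}" using e(2) ab by simp
    then consider "i = \<tau> a" "j = \<tau> b" | "i = \<tau> b" "j = \<tau> a" unfolding doubleton_eq_iff by blast
    then show ?thesis
    proof cases
      case 1
      then show ?thesis using U e(1) unfolding ab by blast
    next
      case 2
      then show ?thesis using U e(1) unfolding ab by (subst (asm) insert_commute) blast
    qed
  qed
  have fc: "?f x \<in> confs U q' F" if "x \<in> confs W q ?E" for x
  proof -
    have "?f x i \<noteq> ?f x j" if ij: "{i, j} \<in> F" for i j
    proof -
      have "{\<tau> i, \<tau> j} \<in> ?E" using imageI[OF ij, of "(`) \<tau>"] by simp
      then have "x (\<tau> i) \<noteq> x (\<tau> j)" using \<open>x \<in> confs W q ?E\<close> unfolding X by blast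
      then show ?thesis using FU[OF ij] by simp
    qed
    then show ?thesis unfolding Y by simp
  qed
  have gt: "?g y (\<tau> a) = y a" if "a \<in> U" for y a
    using that \<tau> by (auto simp: inv_into_f_f)
  have gc: "?g y \<in> confs W q ?E" if "y \<in> confs U q' F" for y
  proof -
    have "?g y i \<noteq> ?g y j" if ij: "{i, j} \<in> ?E" for i j
    proof -
      obtain a b where "a \<in> U" "b \<in> U" "{a, b} \<in> F" "i = \<tau> a" "j = \<tau> b" using edge[OF ij] by blast
      moreover have "y a \<noteq> y b" using \<open>y \<in> confs U q' F\<close> \<open>{a, b} \<in> F\<close> unfolding Y by blast
      ultimately show ?thesis using gt by metis
    qed
    then show ?thesis unfolding X by simp
  qed
  have cf: "continuous_map ?X ?Y ?f"
  proof -
    have "continuous_map ?X (power_space U) ?f"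
      unfolding conf_space_def
    proof (subst continuous_map_componentwise, intro conjI ballI)
      fix a assume "a \<in> U"
      then have "\<tau> a \<in> W" using \<tau>(2) by blast
      note proj = continuous_map_from_subtopology[OF continuous_map_product_projection[OF this, of "\<lambda>_. euclidean"]]
      show "continuous_map (subtopology (power_space W) (confs W q ?E)) euclidean (\<lambda>x. ?f x a)"
        using \<open>a \<in> U\<close> by (simp add: proj)
    qed auto
    then show ?thesis
      unfolding conf_space_def[of U] by (rule continuous_map_into_subtopology) (use fc in simp)
  qed
  have cg: "continuous_map ?Y ?X ?g"
  proof -
    have "continuous_map ?Y (power_space W) ?g"
      unfolding conf_space_def
    proof (subst continuous_map_componentwise, intro conjI ballI)
      fix w assume w: "w \<in> W"
      show "continuous_map (subtopology (power_space U) (confs U q' F)) euclidean (\<lambda>y. ?g y w)"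
      proof (cases "w \<in> \<tau> ` U")
        case True
        then have "inv_into U \<tau> w \<in> U" by (rule inv_into_into)
        note proj = continuous_map_from_subtopology[OF continuous_map_product_projection[OF this, of "\<lambda>_. euclidean"]]
        show ?thesis using w True by (simp add: proj)
      qed (use w in simp)
    qed auto
    then show ?thesis
      unfolding conf_space_def[of W] by (rule continuous_map_into_subtopology) (use gc in simp)
  qed
  have fg: "?f (?g y) = y" if "y \<in> confs U q' F" for y
  proof -
    have "y \<in> extensional U" using that unfolding Y by blast
    moreover have "?f (?g y) a = y a" if "a \<in> U" for a using gt[OF that] that by simp
    ultimately show ?thesis by (intro extensionalityI[of _ U]) auto
  qed
  have "homotopic_with (\<lambda>_. True) ?X ?X id (?g \<circ> ?f)"
  proof (rule homotopic_with_straight_line[OF conf_space_def confs_extensional continuous_map_compose[OF cf cg]])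
    fix x and t :: real
    assume x: "x \<in> confs W q ?E"
    let ?z = "\<lambda>i\<in>W. (1 - t) *\<^sub>R x i + t *\<^sub>R (?g \<circ> ?f) x i"
    \<comment> \<open>The homotopy is stationary on the image of \<open>\<tau>\<close>, which
      contains the ends of all edges, so no edge condition is broken on the way.\<close>
    have z: "?z (\<tau> a) = x (\<tau> a)" if "a \<in> U" for a
    proof -
      have "(?g \<circ> ?f) x (\<tau> a) = x (\<tau> a)" using gt[OF that, of "?f x"] that by simp
      moreover have "\<tau> a \<in> W" using that \<tau>(2) by blast
      ultimately show ?thesis by (simp add: algebra_simps flip: scaleR_add_left)
    qed
    have "?z i \<noteq> ?z j" if ij: "{i, j} \<in> ?E" for i j
    proof -
      obtain a b where ab: "a \<in> U" "b \<in> U" "i = \<tau> a" "j = \<tau> b" using edge[OF ij] by blast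
      have "x i \<noteq> x j" using x ij unfolding X by blast
      then show ?thesis unfolding ab(3,4) z[OF ab(1)] z[OF ab(2)] .
    qed
    then show "?z \<in> confs W q ?E" unfolding X by simp
  qed
  then have "homotopic_with (\<lambda>_. True) ?X ?X (?g \<circ> ?f) id" by (simp only: homotopic_with_sym)
  moreover have "homotopic_with (\<lambda>_. True) ?Y ?Y (?f \<circ> ?g) id"
    by (rule homotopic_with_equal) (use fg continuous_map_compose[OF cg cf] in auto)
  ultimately show ?thesis
    unfolding homotopy_equivalent_space_def using cf cg by blast
qed

lemma poincare_homotopy_equivalent:
  assumes "X homotopy_equivalent_space Y" "\<And>p. finite_rank (homology_group p Y)"
  shows "poincare X = poincare Y"
  unfolding poincare_def
  using grank_iso(2)[OF abelian_homology_group abelian_homology_group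
      homotopy_equivalent_space_imp_isomorphic_homology_groups[OF assms(1)] assms(2)]
  by simp

text \<open>The edges of the complete graph on \<open>R\<close>.\<close>

definition pairs :: "'i set \<Rightarrow> 'i set set" where
  "pairs R = {e. e \<subseteq> R \<and> card e = 2}"

lemma graph_on_Un_pairs:
  "graph_on V R E \<Longrightarrow> graph_on (V \<union> R) {} (E \<union> pairs R)"
  by (auto simp: graph_on_def pairs_def)

lemma graph_on_pairs: "finite R \<Longrightarrow> graph_on R {} (pairs R)"
  by (auto simp: graph_on_def pairs_def)

text \<open>The absorbed vertex lies outside \<open>R\<close>, so contraction leaves the complete
  graph on the obstacles intact.\<close>

lemma contract_Un_pairs:
  assumes "k \<notin> R"
  shows "contract k j (E \<union> pairs R) = contract k j E \<union> pairs R"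
proof -
  have "merge_vertex k j ` e = e \<and> e \<noteq> {k, j}" if "e \<in> pairs R" for e
  proof -
    have "k \<notin> e" using that assms by (auto simp: pairs_def)
    then have "merge_vertex k j ` e = (\<lambda>i. i) ` e" by (intro image_cong) (auto simp: merge_vertex_def)
    then show ?thesis using \<open>k \<notin> e\<close> by auto
  qed
  then have "(\<lambda>e. merge_vertex k j ` e) ` (pairs R - {{k, j}}) = pairs R" by force
  then show ?thesis unfolding contract_def Un_Diff image_Un by (rule arg_cong)
qed

text \<open>The induction runs on the pinned graph. When \<open>j\<close> is an obstacle, the same
  contracted edge set means pinning \<open>k\<close> on the right and merging it with a free
  obstacle on the left. The recursion is linear, so the factor of the complete graph passes through
  it.\<close>

theorem poincare_pinned_factorization:
  fixes q :: "'i \<Rightarrow> 'a::euclidean_space" and q' :: "'i \<Rightarrow> 'a"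
  assumes "graph_on V R E" and q: "inj_on q R"
  shows "poincare (conf_space (V \<union> R) q' (E \<union> pairs R))
    = poincare (conf_space R q' (pairs R)) * poincare (conf_space V q E)"
  using assms(1)
proof (induction rule: graph_deletion_contraction_induct)
  case (base V E)
  \<comment> \<open>In the base case the remaining edges join obstacles and already belong to the
    complete graph; the vertices of \<open>V\<close> are then isolated.\<close>
  have "e \<in> pairs R" if "e \<in> E" for e
  proof -
    have "e \<subseteq> V \<union> R \<and> card e = 2" using base(1) that unfolding graph_on_def by (elim conjE) (erule bspec)
    then show ?thesis using base(2)[OF that] by (auto simp: pairs_def)
  qed
  then have E: "E \<union> pairs R = pairs R" by blast
  have "graph_on R {} (pairs R)" using base(1) by (intro graph_on_pairs) (simp add: graph_on_def)
  then have "conf_space (V \<union> R) q' ((`) id ` pairs R) homotopy_equivalent_space conf_space R q' (pairs R)"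
    by (intro conf_space_homotopy_equivalent_relabel) auto
  then have "poincare (conf_space (V \<union> R) q' (pairs R)) = poincare (conf_space R q' (pairs R))"
    using conf_space_homology_free[OF \<open>graph_on R {} (pairs R)\<close>] by (intro poincare_homotopy_equivalent) auto
  then show ?case by (simp add: E poincare_no_free_edges[OF base(1) q base(2)])
next
  case (step V E k j)
  have kR: "k \<notin> R" using step.hyps(1,2) by (auto simp: graph_on_def)
  then have "{k, j} \<notin> pairs R" by (auto simp: pairs_def)
  then have 1: "E \<union> pairs R - {{k, j}} = (E - {{k, j}}) \<union> pairs R" by (simp add: Un_Diff)
  have 2: "V \<union> R - {k} = (V - {k}) \<union> R" using kR by auto
  have "poincare (conf_space (V \<union> R) q' (E \<union> pairs R)) = poincare (conf_space (V \<union> R) q' ((E - {{k, j}}) \<union> pairs R))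
    + fps_X ^ (DIM('a) - 1) * poincare (conf_space ((V - {k}) \<union> R) q' (contract k j E \<union> pairs R))"
    using poincare_deletion_contraction[OF graph_on_Un_pairs[OF step.hyps(1)] inj_on_empty UnI1[OF step.hyps(2)] step.hyps(3) UnI1[OF step.hyps(4)], of q']
    unfolding 1 2 contract_Un_pairs[OF kR] .
  then show ?case
    unfolding step.IH poincare_deletion_contraction[OF step.hyps(1) q step.hyps(2-4)]
    by (simp add: algebra_simps)
qed

section \<open>The given spaces as configurations with pinned vertices\<close>

lemma conf_graph_eq_conf_space:
  assumes "\<And>e. e \<in> E \<Longrightarrow> e \<subseteq> {1..M}"
  shows "conf_graph M E = conf_space {1..M} q E"
proof -
  have "confs {1..M} q E = extensional {1..M} \<inter> {x. \<forall>i j. {i, j} \<in> E \<longrightarrow> x i \<noteq> x j}"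
    by (subst confs_full) (use assms in blast)+
  then show ?thesis
    unfolding conf_graph_def conf_space_def
    by (subst subtopology_restrict[symmetric]) (simp only: topspace_power_space)
qed

text \<open>Obstacle \<open>s\<close> becomes vertex \<open>n + s\<close>, and \<open>i - n\<close>
  recovers its index. Vertices up to \<open>n\<close>, where the subtraction truncates, are
  free.\<close>

lemma conf_CO_eq_conf_space:
  assumes C: "C \<subseteq> {e. e \<subseteq> {1..n} \<and> card e = 2}" and Ob: "Ob \<subseteq> {1..n} \<times> {1..r}"
  shows "conf_CO n C Ob p = conf_space {1..n} (\<lambda>i. p (i - n)) (C \<union> {{k, n + s} | k s. (k, s) \<in> Ob})"
proof -
  let ?V = "{1..n}" and ?q = "\<lambda>i. p (i - n)" and ?O = "{{k, n + s} | k s. (k, s) \<in> Ob}"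
  let ?S = "{x. (\<forall>i j. {i, j} \<in> C \<longrightarrow> x i \<noteq> x j) \<and> (\<forall>(k, s)\<in>Ob. x k \<noteq> p s)}"
  have c: "pinned ?V ?q x i = x i" "pinned ?V ?q x j = x j" if "{i, j} \<in> C" for x i j
  proof -
    have "{i, j} \<subseteq> ?V" using subsetD[OF C that] unfolding mem_Collect_eq by (rule conjunct1)
    then show "pinned ?V ?q x i = x i" "pinned ?V ?q x j = x j" by (simp_all add: pinned_def)
  qed
  have o: "pinned ?V ?q x k = x k" "pinned ?V ?q x (n + s) = p s" if "(k, s) \<in> Ob" for x k s
    using subsetD[OF Ob that] by (simp_all add: pinned_def)
  have "(\<forall>i j. {i, j} \<in> C \<union> ?O \<longrightarrow> pinned ?V ?q x i \<noteq> pinned ?V ?q x j) \<longleftrightarrow> x \<in> ?S" for x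
  proof
    assume L: "\<forall>i j. {i, j} \<in> C \<union> ?O \<longrightarrow> pinned ?V ?q x i \<noteq> pinned ?V ?q x j"
    have 1: "x i \<noteq> x j" if "{i, j} \<in> C" for i j
      using L[rule_format, OF UnI1[OF that]] unfolding c[OF that] .
    have 2: "x k \<noteq> p s" if "(k, s) \<in> Ob" for k s
    proof -
      have "{k, n + s} \<in> ?O" using that by blast
      from L[rule_format, OF UnI2[OF this]] show ?thesis unfolding o[OF that] .
    qed
    show "x \<in> ?S"
      unfolding mem_Collect_eq by (intro conjI allI impI ballI) (auto dest: 1 2)
  next
    assume R: "x \<in> ?S"
    show "\<forall>i j. {i, j} \<in> C \<union> ?O \<longrightarrow> pinned ?V ?q x i \<noteq> pinned ?V ?q x j"
    proof (intro allI impI)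
      fix i j assume "{i, j} \<in> C \<union> ?O"
      then consider "{i, j} \<in> C" | k s where "(k, s) \<in> Ob" "{i, j} = {k, n + s}" by blast
      then show "pinned ?V ?q x i \<noteq> pinned ?V ?q x j"
      proof cases
        case 1
        then have "x i \<noteq> x j" using R by blast
        then show ?thesis unfolding c[OF 1] .
      next
        case (2 k s)
        then have "x k \<noteq> p s" using R by blast
        moreover have "i = k \<and> j = n + s \<or> i = n + s \<and> j = k" using 2(2) by (simp add: doubleton_eq_iff)
        ultimately show ?thesis using o[OF 2(1), of x] by (elim disjE conjE) (simp_all only: simp_thms, metis+)
      qed
    qed
  qed
  then have "confs ?V ?q (C \<union> ?O) = extensional ?V \<inter> ?S" unfolding confs_def by blast
  moreover have "subtopology (power_space ?V) ?S = subtopology (power_space ?V) (extensional ?V \<inter> ?S)"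
    by (subst subtopology_restrict[symmetric]) (simp only: topspace_power_space)
  ultimately show ?thesis unfolding conf_CO_def conf_space_def by simp
qed

lemma pairs_image:
  assumes "inj_on f R"
  shows "(`) f ` pairs R = pairs (f ` R)"
proof (intro equalityI subsetI)
  fix e assume "e \<in> (`) f ` pairs R"
  then obtain d where d: "d \<subseteq> R" "card d = 2" "e = f ` d" by (auto simp: pairs_def)
  then have "card e = 2" using inj_on_subset[OF assms] by (simp add: card_image)
  then show "e \<in> pairs (f ` R)" using d by (simp add: pairs_def image_mono)
next
  fix e assume "e \<in> pairs (f ` R)"
  then have e: "e \<subseteq> f ` R" "card e = 2" by (simp_all add: pairs_def)
  then obtain d where d: "d \<subseteq> R" "inj_on f d" "e = f ` d" by (meson subset_image_inj)
  then have "card d = 2" using e(2) by (simp add: card_image)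
  then show "e \<in> (`) f ` pairs R" using d by (auto simp: pairs_def)
qed

lemma pairs_eq_doubletons: "{{a, b} | a b. a \<in> R \<and> b \<in> R \<and> a \<noteq> b} = pairs R"
  by (fastforce simp: pairs_def card_2_iff)

lemma shifted_doubletons:
  fixes n r :: nat
  shows "{{n + a, n + b} | a b. a \<in> {1..r} \<and> b \<in> {1..r} \<and> a \<noteq> b} = (`) ((+) n) ` pairs {1..r}"
  unfolding pairs_eq_doubletons[symmetric] by (auto simp: image_iff) blast+

theorem theorem11p1:
  fixes n r :: nat and C :: "nat set set" and Ob :: "(nat \<times> nat) set"
    and p :: "nat \<Rightarrow> 'a::euclidean_space"
  assumes "DIM('a) \<ge> 2" and "n \<ge> 1" and "r \<ge> 1"
    and "inj_on p {1..r}"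
    and "C \<subseteq> {e. e \<subseteq> {1..n} \<and> card e = 2}"
    and "Ob \<subseteq> {1..n} \<times> {1..r}"
  shows "(\<forall>q. torsion_free (homology_group q (conf_CO n C Ob p)))
    \<and> (\<forall>q. finite_rank (homology_group q (conf_CO n C Ob p)))
    \<and> (\<forall>q. finite_rank (homology_group q (conf_graph (n + r) (gamma_edges n r C Ob) :: (nat \<Rightarrow> 'a) topology)))
    \<and> (\<forall>q. finite_rank (homology_group q (conf_graph r (complete_edges r) :: (nat \<Rightarrow> 'a) topology)))
    \<and> poincare (conf_CO n C Ob p)
        = poincare (conf_graph (n + r) (gamma_edges n r C Ob) :: (nat \<Rightarrow> 'a) topology)
          / poincare (conf_graph r (complete_edges r) :: (nat \<Rightarrow> 'a) topology)"
proof -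
  let ?V = "{1..n}" and ?R = "{n + 1..n + r}" and ?E = "C \<union> {{k, n + s} | k s. (k, s) \<in> Ob}"
  \<comment> \<open>\<open>?q\<close> undoes the shift of the obstacle labels. In the two graph
    spaces every vertex is free, so their pinning function is set to a constant.\<close>
  let ?q = "\<lambda>i. p (i - n)" and ?q' = "\<lambda>_::nat. 0 :: 'a"
  let ?A = "conf_CO n C Ob p" and ?B = "conf_graph (n + r) (gamma_edges n r C Ob) :: (nat \<Rightarrow> 'a) topology"
    and ?K = "conf_graph r (complete_edges r) :: (nat \<Rightarrow> 'a) topology"
  have R: "?R = (+) n ` {1..r}" by (simp add: add.commute)
  have O: "card {k, n + s} = 2 \<and> {k, n + s} \<subseteq> ?V \<union> ?R" if "(k, s) \<in> Ob" for k s
    using subsetD[OF assms(6) that] by (auto simp: card_insert_if)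
  have E: "graph_on ?V ?R ?E"
    unfolding graph_on_def
  proof (intro conjI ballI)
    fix e assume "e \<in> ?E"
    then have "card e = 2 \<and> e \<subseteq> ?V \<union> ?R"
    proof
      assume "e \<in> C"
      from subsetD[OF assms(5) this] show ?thesis unfolding mem_Collect_eq by (elim conjE) (intro conjI le_supI1)
    next
      assume "e \<in> {{k, n + s} | k s. (k, s) \<in> Ob}"
      then obtain k s where ks: "(k, s) \<in> Ob" and e: "e = {k, n + s}" by blast
      show ?thesis unfolding e by (rule O[OF ks])
    qed
    then show "e \<subseteq> ?V \<union> ?R" "card e = 2" by (rule conjunct2, rule conjunct1)
  qed auto
  have q: "inj_on ?q ?R"
    unfolding R by (rule inj_on_imageI) (use assms(4) in \<open>simp add: o_def\<close>)
  have K: "complete_edges r = pairs {1..r}" unfolding complete_edges_def by (rule pairs_eq_doubletons)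
  have pR: "(`) ((+) n) ` pairs {1..r} = pairs ?R"
    unfolding R by (rule pairs_image) simp
  have G: "gamma_edges n r C Ob = ?E \<union> pairs ?R"
    unfolding gamma_edges_def shifted_doubletons pR ..
  have VR: "?V \<union> ?R = {1..n + r}" by auto
  have A: "?A = conf_space ?V ?q ?E" by (rule conf_CO_eq_conf_space[OF assms(5,6)])
  have gB: "graph_on (?V \<union> ?R) {} (?E \<union> pairs ?R)" by (rule graph_on_Un_pairs[OF E])
  have "e \<subseteq> {1..n + r}" if "e \<in> gamma_edges n r C Ob" for e
    using gB that unfolding G VR[symmetric] graph_on_def by (elim conjE) (drule (1) bspec, simp only: Un_empty_right)
  then have B: "?B = conf_space (?V \<union> ?R) ?q' (?E \<union> pairs ?R)"
    unfolding VR G[symmetric] by (rule conf_graph_eq_conf_space)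
  have gK: "graph_on {1..r} {} (pairs {1..r})" by (rule graph_on_pairs) simp
  have K': "?K = conf_space {1..r} ?q' (pairs {1..r})"
    unfolding K by (rule conf_graph_eq_conf_space) (simp add: pairs_def)
  \<comment> \<open>The factorization yields the complete graph on the shifted labels, whereas
    \<open>complete_edges\<close> uses \<open>{1..r}\<close>; relabelling by the shift connects
    them.\<close>
  have "conf_space ?R ?q' (pairs ?R) homotopy_equivalent_space ?K"
    unfolding K' pR[symmetric] by (rule conf_space_homotopy_equivalent_relabel[OF _ _ gK]) (auto simp: R)
  then have PK: "poincare (conf_space ?R ?q' (pairs ?R)) = poincare ?K"
    using conf_space_homology_free[OF gK inj_on_empty, of _ ?q'] unfolding K' by (intro poincare_homotopy_equivalent) auto
  \<comment> \<open>The factorization is a product formula; a nonzero factor can be cancelled in the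
    division of power series.\<close>
  have "poincare ?K \<noteq> 0"
    using poincare_nth_0_ge_1[OF gK inj_on_empty, of ?q'] unfolding K' by auto
  moreover have "poincare ?B = poincare ?K * poincare ?A"
    unfolding A B PK[symmetric] by (rule poincare_pinned_factorization[OF E q])
  ultimately have "poincare ?A = poincare ?B / poincare ?K" by simp
  moreover have "\<forall>d. torsion_free (homology_group d ?A) \<and> finite_rank (homology_group d ?A)"
    unfolding A using conf_space_homology_free[OF E q] by blast
  moreover have "\<forall>d. finite_rank (homology_group d ?B)"
    unfolding B using conf_space_homology_free[OF gB inj_on_empty] by blast
  moreover have "\<forall>d. finite_rank (homology_group d ?K)"
    unfolding K' using conf_space_homology_free[OF gK inj_on_empty] by blast
  ultimately show ?thesis by blast
qed

end
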